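(* Let $n\in\mathbb N$. The norm-completion of the normed space $(RL_n,\|\cdot\|_u)$ is isometrically isomorphic with $(C([0,1]^n),\|\cdot\|_\infty)$.
   Context: An MV-algebra is a structure $(A,\oplus,{}^*,0)$ with $(A,\oplus,0)$ an Abelian monoid, $x^{**}=x$, $(x^*\oplus y)^*\oplus y=(y^*\oplus x)^*\oplus x$, $0^*\oplus x=0^*$; $1=0^*$, $x\odot y=(x^*\oplus y^* )^*$, and $d(x,y)=(x^*\odot y)\oplus(x\odot y^* )$. A Riesz MV-algebra is an MV-algebra with unary operations $x\mapsto rx$, $r\in[0,1]$, satisfying $r(x\odot y^* )=(rx)\odot(ry)^*$, $(r\odot q^* )x=(rx)\odot(qx)^*$, $r(qx)=(rq)x$, $1x=x$ (with $r\odot q^*=\max(0,r-q)$ for reals). The logic $\mathcal R\text{Ł}$: formulas are built from propositional variables with $\neg$, $\rightarrow$ and unary $\nabla_r$, $r\in[0,1]$; with $\varphi\vee\psi=(\varphi\to\psi)\to\psi$, $\varphi\leftrightarrow\psi=\neg((\varphi\to\psi)\to\neg(\psi\to\varphi))$, $\Delta_r\varphi=\neg\nabla_r\neg\varphi$, the axioms are $\varphi\to(\psi\to\varphi)$; $(\varphi\to\psi)\to((\psi\to\chi)\to(\varphi\to\chi))$; $(\varphi\vee\psi)\to(\psi\vee\varphi)$; $(\neg\psi\to\neg\varphi)\to(\varphi\to\psi)$; $\nabla_r(\varphi\to\psi)\leftrightarrow(\nabla_r\varphi\to\nabla_r\psi)$; $\nabla_{r\odot q^*}\varphi\leftrightarrow(\nabla_q\varphi\to\nabla_r\varphi)$;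 $\nabla_r(\nabla_q\varphi)\leftrightarrow\nabla_{rq}\varphi$; $\nabla_1\varphi\leftrightarrow\varphi$; the only rule is modus ponens. $RL_n$ is the Lindenbaum–Tarski algebra of formulas in the variables $v_1,\dots,v_n$ modulo provable equivalence, a Riesz MV-algebra with $[\varphi]^*=[\neg\varphi]$, $[\varphi]\oplus[\psi]=[\neg\varphi\to\psi]$, $r[\varphi]=[\Delta_r\varphi]$. The term function $f_\varphi:[0,1]^n\to[0,1]$ of $\varphi$ interprets $\neg$ by $1-x$, $\to$ by $\min(1,1-x+y)$ and $\nabla_r$ by $1-r(1-x)$; via $[\varphi]\mapsto f_\varphi$ the algebra $RL_n$ is isomorphic to the Riesz MV-algebra $RMV_n$ of all continuous piecewise linear functions $[0,1]^n\to[0,1]$ with real coefficients. The norm is $\|[\varphi]\|_u=\sup\{f_\varphi(\mathbf x)\mid\mathbf x\in[0,1]^n\}$, inducing the metric $(x,y)\mapsto\|d(x,y)\|_u$ on $RL_n$; the norm-completion is the Cauchy completion with respect to this metric, with operations extended by continuity. $C([0,1]^n)$ is the Riesz MV-algebra of all continuous functions $[0,1]^n\to[0,1]$ with pointwise operations $\min(1,f+g)$, $1-f$, $rf$, and $\|\cdot\|_\infty$ is the sup-norm, inducing the metric $\|f-g\|_\infty$. *)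

theory Defs
  imports "HOL-Analysis.Analysis"
begin

section \<open>The scalars \<open>r \<in> [0,1]\<close>\<close>

typedef unit_interval = "{0..1::real}"
  by auto

definition ui_one :: unit_interval where
  "ui_one = Abs_unit_interval 1"

definition ui_mult :: "unit_interval \<Rightarrow> unit_interval \<Rightarrow> unit_interval" where
  "ui_mult r q = Abs_unit_interval (Rep_unit_interval r * Rep_unit_interval q)"

text \<open>\<open>r \<odot> q\<^sup>*\<close> in the standard MV-algebra on \<open>[0,1]\<close>.\<close>
definition ui_minus :: "unit_interval \<Rightarrow> unit_interval \<Rightarrow> unit_interval" where
  "ui_minus r q = Abs_unit_interval (max 0 (Rep_unit_interval r - Rep_unit_interval q))"


section \<open>Riesz MV-algebras\<close>

record 'a riesz_mv =
  carr :: "'a set"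
  zero :: 'a  (\<open>\<zero>\<index>\<close>)
  oplus :: "'a \<Rightarrow> 'a \<Rightarrow> 'a"  (infixl \<open>\<oplus>\<index>\<close> 65)
  neg :: "'a \<Rightarrow> 'a"  (\<open>\<sim>\<index> _\<close> [81] 80)
  scal :: "unit_interval \<Rightarrow> 'a \<Rightarrow> 'a"  (infixr \<open>\<cdot>\<index>\<close> 75)

definition odot :: "('a, 'm) riesz_mv_scheme \<Rightarrow> 'a \<Rightarrow> 'a \<Rightarrow> 'a"  (infixl \<open>\<odot>\<index>\<close> 70) where
  "odot A x y = \<sim>\<^bsub>A\<^esub> (\<sim>\<^bsub>A\<^esub> x \<oplus>\<^bsub>A\<^esub> \<sim>\<^bsub>A\<^esub> y)"

definition mv_dist :: "('a, 'm) riesz_mv_scheme \<Rightarrow> 'a \<Rightarrow> 'a \<Rightarrow> 'a" where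
  "mv_dist A x y = (\<sim>\<^bsub>A\<^esub> x \<odot>\<^bsub>A\<^esub> y) \<oplus>\<^bsub>A\<^esub> (x \<odot>\<^bsub>A\<^esub> \<sim>\<^bsub>A\<^esub> y)"

locale mv_algebra =
  fixes A :: "('a, 'm) riesz_mv_scheme" (structure)
  assumes zero_closed: "\<zero> \<in> carr A"
    and oplus_closed: "\<lbrakk>x \<in> carr A; y \<in> carr A\<rbrakk> \<Longrightarrow> x \<oplus> y \<in> carr A"
    and neg_closed: "x \<in> carr A \<Longrightarrow> \<sim> x \<in> carr A"
    and oplus_assoc: "\<lbrakk>x \<in> carr A; y \<in> carr A; z \<in> carr A\<rbrakk> \<Longrightarrow> (x \<oplus> y) \<oplus> z = x \<oplus> (y \<oplus> z)"
    and oplus_commute: "\<lbrakk>x \<in> carr A; y \<in> carr A\<rbrakk> \<Longrightarrow> x \<oplus> y = y \<oplus> x"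
    and oplus_zero: "x \<in> carr A \<Longrightarrow> x \<oplus> \<zero> = x"
    and neg_neg: "x \<in> carr A \<Longrightarrow> \<sim> (\<sim> x) = x"
    and mangani: "\<lbrakk>x \<in> carr A; y \<in> carr A\<rbrakk> \<Longrightarrow> \<sim> (\<sim> x \<oplus> y) \<oplus> y = \<sim> (\<sim> y \<oplus> x) \<oplus> x"
    and one_absorb: "x \<in> carr A \<Longrightarrow> \<sim> \<zero> \<oplus> x = \<sim> \<zero>"

locale riesz_mv_algebra = mv_algebra A for A :: "('a, 'm) riesz_mv_scheme" (structure) +
  assumes scal_closed: "x \<in> carr A \<Longrightarrow> r \<cdot> x \<in> carr A"
    and scal_odot: "\<lbrakk>x \<in> carr A; y \<in> carr A\<rbrakk> \<Longrightarrow> r \<cdot> (x \<odot> \<sim> y) = (r \<cdot> x) \<odot> \<sim> (r \<cdot> y)"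
    and minus_scal: "x \<in> carr A \<Longrightarrow> ui_minus r q \<cdot> x = (r \<cdot> x) \<odot> \<sim> (q \<cdot> x)"
    and scal_scal: "x \<in> carr A \<Longrightarrow> r \<cdot> (q \<cdot> x) = ui_mult r q \<cdot> x"
    and one_scal: "x \<in> carr A \<Longrightarrow> ui_one \<cdot> x = x"

record 'a normed_riesz_mv = "'a riesz_mv" +
  nrm :: "'a \<Rightarrow> real"
  mdist :: "'a \<Rightarrow> 'a \<Rightarrow> real"

definition isometric_isomorphism ::
    "('a, 'm) normed_riesz_mv_scheme \<Rightarrow> ('b, 'k) normed_riesz_mv_scheme \<Rightarrow> ('a \<Rightarrow> 'b) \<Rightarrow> bool" where
  "isometric_isomorphism A B h \<longleftrightarrow>
     bij_betw h (carr A) (carr B) \<and>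
     h \<zero>\<^bsub>A\<^esub> = \<zero>\<^bsub>B\<^esub> \<and>
     (\<forall>x\<in>carr A. \<forall>y\<in>carr A. h (x \<oplus>\<^bsub>A\<^esub> y) = h x \<oplus>\<^bsub>B\<^esub> h y) \<and>
     (\<forall>x\<in>carr A. h (\<sim>\<^bsub>A\<^esub> x) = \<sim>\<^bsub>B\<^esub> (h x)) \<and>
     (\<forall>r. \<forall>x\<in>carr A. h (r \<cdot>\<^bsub>A\<^esub> x) = r \<cdot>\<^bsub>B\<^esub> h x) \<and>
     (\<forall>x\<in>carr A. nrm B (h x) = nrm A x) \<and>
     (\<forall>x\<in>carr A. \<forall>y\<in>carr A. mdist B (h x) (h y) = mdist A x y)"

definition isometrically_isomorphic ::
    "('a, 'm) normed_riesz_mv_scheme \<Rightarrow> ('b, 'k) normed_riesz_mv_scheme \<Rightarrow> bool" where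
  "isometrically_isomorphic A B \<longleftrightarrow>
     riesz_mv_algebra A \<and> riesz_mv_algebra B \<and> (\<exists>h. isometric_isomorphism A B h)"


section \<open>Norm-completion\<close>

definition cauchy_seqs :: "('a, 'm) normed_riesz_mv_scheme \<Rightarrow> (nat \<Rightarrow> 'a) set" where
  "cauchy_seqs A = {x. (\<forall>k. x k \<in> carr A) \<and>
     (\<forall>e>0. \<exists>N. \<forall>i\<ge>N. \<forall>j\<ge>N. mdist A (x i) (x j) < e)}"

definition cauchy_rel :: "('a, 'm) normed_riesz_mv_scheme \<Rightarrow> ((nat \<Rightarrow> 'a) \<times> (nat \<Rightarrow> 'a)) set" where
  "cauchy_rel A = {(x, y). x \<in> cauchy_seqs A \<and> y \<in> cauchy_seqs A \<and>
     (\<lambda>k. mdist A (x k) (y k)) \<longlonglongrightarrow> 0}"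

text \<open>
  Elements are classes of Cauchy sequences. The continuous extension of an operation (or of the
  norm or metric) sends the classes of \<open>(x\<^sub>k)\<close>, \<open>(y\<^sub>k)\<close> to the class (or the limit) of the values
  at \<open>x\<^sub>k\<close>, \<open>y\<^sub>k\<close>.
\<close>
definition norm_completion ::
    "('a, 'm) normed_riesz_mv_scheme \<Rightarrow> (nat \<Rightarrow> 'a) set normed_riesz_mv" where
  "norm_completion A = \<lparr>
     carr = cauchy_seqs A // cauchy_rel A,
     zero = cauchy_rel A `` {\<lambda>k. \<zero>\<^bsub>A\<^esub>},
     oplus = (\<lambda>X Y. \<Union>x\<in>X. \<Union>y\<in>Y. cauchy_rel A `` {\<lambda>k. x k \<oplus>\<^bsub>A\<^esub> y k}),
     neg = (\<lambda>X. \<Union>x\<in>X. cauchy_rel A `` {\<lambda>k. \<sim>\<^bsub>A\<^esub> (x k)}),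
     scal = (\<lambda>r X. \<Union>x\<in>X. cauchy_rel A `` {\<lambda>k. r \<cdot>\<^bsub>A\<^esub> x k}),
     nrm = (\<lambda>X. the_elem ((\<lambda>x. lim (\<lambda>k. nrm A (x k))) ` X)),
     mdist = (\<lambda>X Y. the_elem ((\<lambda>(x, y). lim (\<lambda>k. mdist A (x k) (y k))) ` (X \<times> Y)))\<rparr>"


section \<open>The logic and its Lindenbaum-Tarski algebras\<close>

datatype fm =
    Var nat
  | Neg fm
  | Imp fm fm  (infixr \<open>\<rightarrow>\<^sub>L\<close> 60)
  | Nabla unit_interval fm

definition Disj :: "fm \<Rightarrow> fm \<Rightarrow> fm"  (infixr \<open>\<or>\<^sub>L\<close> 65) where
  "\<phi> \<or>\<^sub>L \<psi> = (\<phi> \<rightarrow>\<^sub>L \<psi>) \<rightarrow>\<^sub>L \<psi>"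

definition Iff :: "fm \<Rightarrow> fm \<Rightarrow> fm"  (infix \<open>\<leftrightarrow>\<^sub>L\<close> 55) where
  "\<phi> \<leftrightarrow>\<^sub>L \<psi> = Neg ((\<phi> \<rightarrow>\<^sub>L \<psi>) \<rightarrow>\<^sub>L Neg (\<psi> \<rightarrow>\<^sub>L \<phi>))"

definition Delta :: "unit_interval \<Rightarrow> fm \<Rightarrow> fm" where
  "Delta r \<phi> = Neg (Nabla r (Neg \<phi>))"

inductive provable :: "fm \<Rightarrow> bool"  (\<open>\<turnstile>\<^sub>L _\<close> [50] 50) where
  L1: "\<turnstile>\<^sub>L \<phi> \<rightarrow>\<^sub>L (\<psi> \<rightarrow>\<^sub>L \<phi>)"
| L2: "\<turnstile>\<^sub>L (\<phi> \<rightarrow>\<^sub>L \<psi>) \<rightarrow>\<^sub>L ((\<psi> \<rightarrow>\<^sub>L \<theta>) \<rightarrow>\<^sub>L (\<phi> \<rightarrow>\<^sub>L \<theta>))"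
| L3: "\<turnstile>\<^sub>L (\<phi> \<or>\<^sub>L \<psi>) \<rightarrow>\<^sub>L (\<psi> \<or>\<^sub>L \<phi>)"
| L4: "\<turnstile>\<^sub>L (Neg \<psi> \<rightarrow>\<^sub>L Neg \<phi>) \<rightarrow>\<^sub>L (\<phi> \<rightarrow>\<^sub>L \<psi>)"
| R1: "\<turnstile>\<^sub>L Nabla r (\<phi> \<rightarrow>\<^sub>L \<psi>) \<leftrightarrow>\<^sub>L (Nabla r \<phi> \<rightarrow>\<^sub>L Nabla r \<psi>)"
| R2: "\<turnstile>\<^sub>L Nabla (ui_minus r q) \<phi> \<leftrightarrow>\<^sub>L (Nabla q \<phi> \<rightarrow>\<^sub>L Nabla r \<phi>)"
| R3: "\<turnstile>\<^sub>L Nabla r (Nabla q \<phi>) \<leftrightarrow>\<^sub>L Nabla (ui_mult r q) \<phi>"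
| R4: "\<turnstile>\<^sub>L Nabla ui_one \<phi> \<leftrightarrow>\<^sub>L \<phi>"
| MP: "\<lbrakk>\<turnstile>\<^sub>L \<phi>; \<turnstile>\<^sub>L \<phi> \<rightarrow>\<^sub>L \<psi>\<rbrakk> \<Longrightarrow> \<turnstile>\<^sub>L \<psi>"

primrec vars :: "fm \<Rightarrow> nat set" where
  "vars (Var i) = {i}"
| "vars (Neg \<phi>) = vars \<phi>"
| "vars (\<phi> \<rightarrow>\<^sub>L \<psi>) = vars \<phi> \<union> vars \<psi>"
| "vars (Nabla r \<phi>) = vars \<phi>"

definition Form :: "nat \<Rightarrow> fm set" where
  "Form n = {\<phi>. vars \<phi> \<subseteq> {1..n}}"

definition prov_equiv :: "nat \<Rightarrow> (fm \<times> fm) set" where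
  "prov_equiv n = {(\<phi>, \<psi>). \<phi> \<in> Form n \<and> \<psi> \<in> Form n \<and> \<turnstile>\<^sub>L \<phi> \<leftrightarrow>\<^sub>L \<psi>}"

text \<open>
  The zero is the class of the negation of a theorem. The formula written here lies in
  \<open>Form n\<close> only for \<open>n \<ge> 1\<close>; \<open>Form 0\<close> is empty, as the language has no constants.
\<close>
definition RL_alg :: "nat \<Rightarrow> fm set riesz_mv" where
  "RL_alg n = \<lparr>
     carr = Form n // prov_equiv n,
     zero = prov_equiv n `` {Neg (Var 1 \<rightarrow>\<^sub>L Var 1)},
     oplus = (\<lambda>X Y. \<Union>\<phi>\<in>X. \<Union>\<psi>\<in>Y. prov_equiv n `` {Neg \<phi> \<rightarrow>\<^sub>L \<psi>}),
     neg = (\<lambda>X. \<Union>\<phi>\<in>X. prov_equiv n `` {Neg \<phi>}),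
     scal = (\<lambda>r X. \<Union>\<phi>\<in>X. prov_equiv n `` {Delta r \<phi>})\<rparr>"

text \<open>
  \<open>[0,1]\<^sup>n\<close> with coordinates indexed by \<open>{1..n}\<close>; points are \<open>undefined\<close> outside \<open>{1..n}\<close>, so the
  topology inherited from the product topology on \<^typ>\<open>nat \<Rightarrow> real\<close> is the usual one.
\<close>
definition cube :: "nat \<Rightarrow> (nat \<Rightarrow> real) set" where
  "cube n = {1..n} \<rightarrow>\<^sub>E {0..1}"

primrec term_fun :: "fm \<Rightarrow> (nat \<Rightarrow> real) \<Rightarrow> real" where
  "term_fun (Var i) x = x i"
| "term_fun (Neg \<phi>) x = 1 - term_fun \<phi> x"
| "term_fun (\<phi> \<rightarrow>\<^sub>L \<psi>) x = min 1 (1 - term_fun \<phi> x + term_fun \<psi> x)"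
| "term_fun (Nabla r \<phi>) x = 1 - Rep_unit_interval r * (1 - term_fun \<phi> x)"

definition u_norm :: "nat \<Rightarrow> fm set \<Rightarrow> real" where
  "u_norm n X = the_elem ((\<lambda>\<phi>. SUP x\<in>cube n. term_fun \<phi> x) ` X)"

definition RL :: "nat \<Rightarrow> fm set normed_riesz_mv" where
  "RL n = riesz_mv.extend (RL_alg n)
     (normed_riesz_mv.fields (u_norm n) (\<lambda>X Y. u_norm n (mv_dist (RL_alg n) X Y)))"


section \<open>The algebra \<open>C([0,1]\<^sup>n)\<close>\<close>

text \<open>Functions are extensional on the cube, so that equality is equality on the cube.\<close>
definition C_cube :: "nat \<Rightarrow> ((nat \<Rightarrow> real) \<Rightarrow> real) normed_riesz_mv" where
  "C_cube n = \<lparr>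
     carr = {f \<in> cube n \<rightarrow>\<^sub>E {0..1}. continuous_on (cube n) f},
     zero = (\<lambda>x\<in>cube n. 0),
     oplus = (\<lambda>f g. \<lambda>x\<in>cube n. min 1 (f x + g x)),
     neg = (\<lambda>f. \<lambda>x\<in>cube n. 1 - f x),
     scal = (\<lambda>r f. \<lambda>x\<in>cube n. Rep_unit_interval r * f x),
     nrm = (\<lambda>f. SUP x\<in>cube n. \<bar>f x\<bar>),
     mdist = (\<lambda>f g. SUP x\<in>cube n. \<bar>f x - g x\<bar>)\<rparr>"

end

theory Submission
  imports Defs
begin

text \<open>
  The term function of a formula is determined by its class (soundness), and the norm and metric of
  \<open>RL\<^sub>n\<close> are the sup-norm and sup-metric of term functions. Hence \<open>[\<phi>] \<mapsto> f\<^sub>\<phi>\<close> is an isometric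
  homomorphism into \<open>C([0,1]\<^sup>n)\<close>; its image is a lattice which interpolates arbitrary values at two
  points, so it is dense by the lattice form of the Stone-Weierstrass theorem. Since \<open>C([0,1]\<^sup>n)\<close> is
  complete, sending \<open>f\<close> to the set of all sequences of classes whose term functions converge to \<open>f\<close>
  is an isometric isomorphism onto the completion. Neither the injectivity of \<open>[\<phi>] \<mapsto> f\<^sub>\<phi>\<close>
  (completeness of the logic) nor the description of its image (McNaughton's theorem) is needed:
  the completion identifies points at distance zero anyway.
\<close>

section \<open>Lukasiewicz derivations\<close>

lemma provable_trans:
  assumes "\<turnstile>\<^sub>L p \<rightarrow>\<^sub>L q" "\<turnstile>\<^sub>L q \<rightarrow>\<^sub>L r"
  shows "\<turnstile>\<^sub>L p \<rightarrow>\<^sub>L r"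
  using MP[OF assms(2) MP[OF assms(1) L2]] .

text \<open>\<open>L1\<close> weakens \<open>p\<close> to
  \<open>(q \<rightarrow>\<^sub>L p) \<rightarrow>\<^sub>L p\<close>, which is
  \<open>q \<or>\<^sub>L p\<close>, and \<open>L3\<close> commutes this disjunction.\<close>

lemma provable_assertion: "\<turnstile>\<^sub>L p \<rightarrow>\<^sub>L ((p \<rightarrow>\<^sub>L q) \<rightarrow>\<^sub>L q)"
  using provable_trans[OF L1 L3[unfolded Disj_def]] .

text \<open>\<open>L2\<close> turns the premise into \<open>((q \<rightarrow>\<^sub>L r)
  \<rightarrow>\<^sub>L r) \<rightarrow>\<^sub>L (p \<rightarrow>\<^sub>L r)\<close>, whose
  antecedent follows from \<open>q\<close> by \<open>provable_assertion\<close>.\<close>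

lemma provable_exchange: "\<turnstile>\<^sub>L (p \<rightarrow>\<^sub>L (q \<rightarrow>\<^sub>L r)) \<rightarrow>\<^sub>L (q \<rightarrow>\<^sub>L (p \<rightarrow>\<^sub>L r))"
  using provable_trans[OF L2 MP[OF provable_assertion L2]] .

text \<open>Exchanging the premises of \<open>L1\<close> gives
  \<open>q \<rightarrow>\<^sub>L (p \<rightarrow>\<^sub>L p)\<close> for every \<open>q\<close>;
  take an axiom for \<open>q\<close>.\<close>

lemma provable_refl: "\<turnstile>\<^sub>L p \<rightarrow>\<^sub>L p"
  using MP[OF L1 MP[OF L1 provable_exchange]] .

lemma provable_imp_mono_right: "\<turnstile>\<^sub>L q \<rightarrow>\<^sub>L r \<Longrightarrow> \<turnstile>\<^sub>L (p \<rightarrow>\<^sub>L q) \<rightarrow>\<^sub>L (p \<rightarrow>\<^sub>L r)"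
  using MP[OF _ MP[OF L2 provable_exchange]] .

lemma provable_imp_mono_left: "\<turnstile>\<^sub>L q \<rightarrow>\<^sub>L p \<Longrightarrow> \<turnstile>\<^sub>L (p \<rightarrow>\<^sub>L r) \<rightarrow>\<^sub>L (q \<rightarrow>\<^sub>L r)"
  using MP[OF _ L2] .

lemma provable_ex_falso: "\<turnstile>\<^sub>L Neg p \<rightarrow>\<^sub>L (p \<rightarrow>\<^sub>L q)"
  using provable_trans[OF L1 L4] .

text \<open>Ex falso takes \<open>Neg (Neg p)\<close> to
  \<open>Neg p \<rightarrow>\<^sub>L Neg t\<close>, and \<open>L4\<close> takes this to
  \<open>t \<rightarrow>\<^sub>L p\<close>. With a theorem for \<open>t\<close>, the assertion law
  detaches \<open>p\<close>.\<close>

lemma provable_double_neg_elim: "\<turnstile>\<^sub>L Neg (Neg p) \<rightarrow>\<^sub>L p"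
proof -
  let ?t = "p \<rightarrow>\<^sub>L p"
  have "\<turnstile>\<^sub>L Neg (Neg p) \<rightarrow>\<^sub>L (?t \<rightarrow>\<^sub>L p)"
    using provable_trans[OF provable_ex_falso L4] .
  moreover have "\<turnstile>\<^sub>L (?t \<rightarrow>\<^sub>L p) \<rightarrow>\<^sub>L p"
    using MP[OF provable_refl provable_assertion] .
  ultimately show ?thesis by (rule provable_trans)
qed

lemma provable_double_neg_intro: "\<turnstile>\<^sub>L p \<rightarrow>\<^sub>L Neg (Neg p)"
  using MP[OF provable_double_neg_elim L4] .

lemma provable_contrapos:
  assumes "\<turnstile>\<^sub>L p \<rightarrow>\<^sub>L q"
  shows "\<turnstile>\<^sub>L Neg q \<rightarrow>\<^sub>L Neg p"
  using MP[OF provable_trans[OF provable_double_neg_elim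
        provable_trans[OF assms provable_double_neg_intro]] L4] .

text \<open>\<open>Iff\<close> joins the two implications by the strong conjunction
  \<open>Neg (a \<rightarrow>\<^sub>L Neg b)\<close>. Its value can be smaller than the minimum of
  both, but at the level of theorems it acts as an ordinary conjunction.\<close>

lemma provable_Iff_iff: "\<turnstile>\<^sub>L p \<leftrightarrow>\<^sub>L q \<longleftrightarrow> \<turnstile>\<^sub>L p \<rightarrow>\<^sub>L q \<and> \<turnstile>\<^sub>L q \<rightarrow>\<^sub>L p"
proof -
  have conj: "\<turnstile>\<^sub>L Neg (a \<rightarrow>\<^sub>L Neg b) \<longleftrightarrow> \<turnstile>\<^sub>L a \<and> \<turnstile>\<^sub>L b" for a b
  proof
    assume *: "\<turnstile>\<^sub>L Neg (a \<rightarrow>\<^sub>L Neg b)"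
    have "\<turnstile>\<^sub>L a"
      using MP[OF MP[OF * provable_contrapos[OF provable_ex_falso]] provable_double_neg_elim] .
    moreover have "\<turnstile>\<^sub>L b"
      using MP[OF MP[OF * provable_contrapos[OF L1]] provable_double_neg_elim] .
    ultimately show "\<turnstile>\<^sub>L a \<and> \<turnstile>\<^sub>L b" ..
  next
    assume ab: "\<turnstile>\<^sub>L a \<and> \<turnstile>\<^sub>L b"
    then have "\<turnstile>\<^sub>L (a \<rightarrow>\<^sub>L Neg b) \<rightarrow>\<^sub>L Neg b"
      using MP[OF _ provable_assertion] by blast
    moreover have "\<turnstile>\<^sub>L Neg (Neg b)"
      using ab MP[OF _ provable_double_neg_intro] by blast
    ultimately show "\<turnstile>\<^sub>L Neg (a \<rightarrow>\<^sub>L Neg b)"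
      using MP[OF _ provable_contrapos] by blast
  qed
  show ?thesis
    unfolding Iff_def by (rule conj)
qed

lemma ui_minus_one_minus_one: "ui_minus ui_one (ui_minus ui_one r) = r"
  using Rep_unit_interval[of r]
  by (auto simp: ui_minus_def ui_one_def Abs_unit_interval_inverse max_def Rep_unit_interval_inverse)

text \<open>Modus ponens is the only rule, so necessitation has to come from the axioms. Writing
  \<open>r\<close> as 1 - (1 - r), \<open>R2\<close> makes \<open>Nabla r p\<close> equivalent to an
  implication with consequent \<open>Nabla ui_one p\<close>, which is equivalent to \<open>p\<close>
  by \<open>R4\<close>.\<close>

lemma provable_necessitation:
  assumes "\<turnstile>\<^sub>L p"
  shows "\<turnstile>\<^sub>L Nabla r p"
proof -
  let ?q = "ui_minus ui_one r"
  have "\<turnstile>\<^sub>L Nabla ui_one p"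
    using MP[OF assms] R4[of p] by (simp add: provable_Iff_iff)
  then have "\<turnstile>\<^sub>L Nabla ?q p \<rightarrow>\<^sub>L Nabla ui_one p"
    using MP[OF _ L1] by blast
  from MP[OF this] R2[of ui_one ?q p] show ?thesis
    by (simp add: provable_Iff_iff ui_minus_one_minus_one)
qed

lemma provable_Nabla_mono:
  assumes "\<turnstile>\<^sub>L p \<rightarrow>\<^sub>L q"
  shows "\<turnstile>\<^sub>L Nabla r p \<rightarrow>\<^sub>L Nabla r q"
  using MP[OF provable_necessitation[OF assms, of r]] R1[of r p q] by (simp add: provable_Iff_iff)

section \<open>Provable equivalence as a congruence\<close>

lemma Iff_Neg_cong: "\<turnstile>\<^sub>L p \<leftrightarrow>\<^sub>L q \<Longrightarrow> \<turnstile>\<^sub>L Neg p \<leftrightarrow>\<^sub>L Neg q"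
  by (simp add: provable_Iff_iff provable_contrapos)

lemma Iff_Imp_cong:
  "\<turnstile>\<^sub>L p \<leftrightarrow>\<^sub>L p' \<Longrightarrow> \<turnstile>\<^sub>L q \<leftrightarrow>\<^sub>L q' \<Longrightarrow> \<turnstile>\<^sub>L (p \<rightarrow>\<^sub>L q) \<leftrightarrow>\<^sub>L (p' \<rightarrow>\<^sub>L q')"
  unfolding provable_Iff_iff
  using provable_trans[OF provable_imp_mono_left provable_imp_mono_right] by blast

lemma Iff_Delta_cong: "\<turnstile>\<^sub>L p \<leftrightarrow>\<^sub>L q \<Longrightarrow> \<turnstile>\<^sub>L Delta r p \<leftrightarrow>\<^sub>L Delta r q"
  by (simp add: Delta_def provable_Iff_iff provable_contrapos provable_Nabla_mono)

lemma Form_simps [simp]: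
  "Neg p \<in> Form n \<longleftrightarrow> p \<in> Form n"
  "p \<rightarrow>\<^sub>L q \<in> Form n \<longleftrightarrow> p \<in> Form n \<and> q \<in> Form n"
  "Delta r p \<in> Form n \<longleftrightarrow> p \<in> Form n"
  "Var i \<in> Form n \<longleftrightarrow> i \<in> {1..n}"
  by (auto simp: Form_def Delta_def)

lemma equiv_prov_equiv: "equiv (Form n) (prov_equiv n)"
proof (rule equivI)
  show "prov_equiv n \<subseteq> Form n \<times> Form n"
    by (auto simp: prov_equiv_def)
  show "refl_on (Form n) (prov_equiv n)"
    by (auto simp: refl_on_def prov_equiv_def provable_Iff_iff provable_refl)
  show "sym (prov_equiv n)"
    by (auto simp: sym_def prov_equiv_def provable_Iff_iff)
  show "trans (prov_equiv n)"
    by (rule transI) (auto simp: prov_equiv_def provable_Iff_iff dest: provable_trans)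
qed

section \<open>Term functions\<close>

lemma Rep_ui_bounds: "0 \<le> Rep_unit_interval r" "Rep_unit_interval r \<le> 1"
  using Rep_unit_interval[of r] by auto

lemma Rep_ui_one: "Rep_unit_interval ui_one = 1"
  by (simp add: ui_one_def Abs_unit_interval_inverse)

lemma Rep_ui_mult: "Rep_unit_interval (ui_mult r q) = Rep_unit_interval r * Rep_unit_interval q"
  by (simp add: ui_mult_def Abs_unit_interval_inverse Rep_ui_bounds mult_le_one)

lemma Rep_ui_minus:
  "Rep_unit_interval (ui_minus r q) = max 0 (Rep_unit_interval r - Rep_unit_interval q)"
  using Rep_ui_bounds[of r] Rep_ui_bounds[of q]
  by (simp add: ui_minus_def Abs_unit_interval_inverse)

lemma term_fun_Delta: "term_fun (Delta r p) x = Rep_unit_interval r * term_fun p x"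
  by (simp add: Delta_def)

lemma term_fun_bounds:
  assumes "\<And>i. i \<in> vars p \<Longrightarrow> x i \<in> {0..1}"
  shows "term_fun p x \<in> {0..1}"
  using assms
proof (induction p)
  case (Imp p q)
  then have "term_fun p x \<in> {0..1}" "term_fun q x \<in> {0..1}" by simp_all
  then show ?case by simp
next
  case (Nabla r p)
  then have *: "term_fun p x \<in> {0..1}" by simp
  then have "Rep_unit_interval r * (1 - term_fun p x) \<le> 1"
    using Rep_ui_bounds[of r] by (intro mult_le_one) auto
  with * show ?case using Rep_ui_bounds[of r] by simp
qed simp_all

lemma term_fun_cong:
  "(\<And>i. i \<in> vars p \<Longrightarrow> x i = y i) \<Longrightarrow> term_fun p x = term_fun p y"
  by (induction p) auto

text \<open>At least one of the two implications has value 1, so their strong conjunction has the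
  value of the other one, truncated at 0. The truncation matters because \<open>x\<close> is
  arbitrary here and values may leave [0,1].\<close>

lemma term_fun_Iff:
  "term_fun (p \<leftrightarrow>\<^sub>L q) x = max 0 (1 - \<bar>term_fun p x - term_fun q x\<bar>)"
  by (auto simp: Iff_def)

lemma term_fun_Imp_eq_1: "term_fun (p \<rightarrow>\<^sub>L q) x = 1 \<longleftrightarrow> term_fun p x \<le> term_fun q x"
  by (auto simp: min_def)

lemma term_fun_Iff_eq_1: "term_fun (p \<leftrightarrow>\<^sub>L q) x = 1 \<longleftrightarrow> term_fun p x = term_fun q x"
  by (auto simp: term_fun_Iff max_def)

text \<open>Passing to complements 1 - t turns implication into truncated subtraction and
  \<open>Nabla r\<close> into multiplication by r. In this form \<open>R1\<close> and
  \<open>R2\<close> say that multiplication by a nonnegative number distributes over truncated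
  differences.\<close>

lemma one_minus_min_eq: "1 - min 1 (1 - (1 - v) + (1 - u)) = max 0 (u - v)" for u v :: real
  by (simp add: min_def max_def)

text \<open>Induction on derivations. Every coordinate of \<open>x\<close> is bounded, since modus
  ponens may pass through formulas with variables that are absent from the conclusion.\<close>

lemma term_fun_provable:
  assumes "\<turnstile>\<^sub>L p" "\<And>i. x i \<in> {0..1}"
  shows "term_fun p x = 1"
  using assms(1)
proof induction
  case (L1 p q)
  show ?case
    unfolding term_fun_Imp_eq_1
    using term_fun_bounds[of p x] term_fun_bounds[of q x] assms(2) by simp
next
  case (L2 p q r)
  show ?case
    unfolding term_fun_Imp_eq_1 by simp
next
  case (L3 p q)
  show ?case
    unfolding Disj_def term_fun_Imp_eq_1
    using term_fun_bounds[of p x] term_fun_bounds[of q x] assms(2) by (simp add: min_def)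
next
  case (L4 q p)
  show ?case
    unfolding term_fun_Imp_eq_1 by simp
next
  case (R1 r p q)
  have *: "r * max 0 t = max 0 (r * t)" if "0 \<le> r" for r t :: real
    using that by (simp add: max_def mult_le_0_iff zero_le_mult_iff)
  have "Rep_unit_interval r * (1 - min 1 (1 - term_fun p x + term_fun q x))
      = Rep_unit_interval r * max 0 (term_fun p x - term_fun q x)"
    by (simp add: min_def max_def)
  also have "\<dots> = max 0 (Rep_unit_interval r * (term_fun p x - term_fun q x))"
    by (rule * [OF Rep_ui_bounds(1)])
  also have "\<dots> = max 0 (Rep_unit_interval r * (1 - term_fun q x) - Rep_unit_interval r * (1 - term_fun p x))"
    by (simp add: algebra_simps)
  finally show ?case
    by (simp add: term_fun_Iff_eq_1 flip: one_minus_min_eq)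
next
  case (R2 r q p)
  have *: "max 0 s * t = max 0 (s * t)" if "0 \<le> t" for s t :: real
    using that by (simp add: max_def mult_le_0_iff zero_le_mult_iff)
  have "0 \<le> 1 - term_fun p x" using term_fun_bounds[of p x] assms(2) by simp
  then have "max 0 (Rep_unit_interval r - Rep_unit_interval q) * (1 - term_fun p x)
      = max 0 (Rep_unit_interval r * (1 - term_fun p x) - Rep_unit_interval q * (1 - term_fun p x))"
    by (simp only: * left_diff_distrib)
  then show ?case
    by (simp add: term_fun_Iff_eq_1 Rep_ui_minus flip: one_minus_min_eq)
next
  case (R3 r q p)
  show ?case by (simp add: term_fun_Iff_eq_1 Rep_ui_mult)
next
  case (R4 p)
  show ?case by (simp add: term_fun_Iff_eq_1 Rep_ui_one)
next
  case (MP p q)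
  then show ?case using term_fun_bounds[of q x] assms(2) by simp
qed

section \<open>Term functions on the cube\<close>

lemma cube_nonempty: "cube n \<noteq> {}"
  by (simp add: cube_def PiE_eq_empty_iff)

lemma term_fun_cube_bounds: "p \<in> Form n \<Longrightarrow> x \<in> cube n \<Longrightarrow> term_fun p x \<in> {0..1}"
  by (rule term_fun_bounds) (auto simp: Form_def cube_def PiE_def Pi_def)

lemma prov_equiv_term_fun:
  assumes "(p, q) \<in> prov_equiv n" "x \<in> cube n"
  shows "term_fun p x = term_fun q x"
proof -
  \<comment> \<open>Coordinates of \<open>x\<close> outside \<open>{1..n}\<close> are
    \<open>undefined\<close>, while soundness asks for values in [0,1] everywhere. Setting them to 0
    leaves the term functions of \<open>Form n\<close> unchanged.\<close>
  define y where "y i = (if i \<in> {1..n} then x i else 0)" for i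
  have "y i \<in> {0..1}" for i
    using assms(2) by (auto simp: y_def cube_def)
  then have "term_fun (p \<leftrightarrow>\<^sub>L q) y = 1"
    using assms(1) term_fun_provable by (auto simp: prov_equiv_def)
  then have "term_fun p y = term_fun q y"
    by (auto simp: term_fun_Iff max_def split: if_splits)
  moreover have "term_fun r x = term_fun r y" if "r \<in> Form n" for r
    using that by (intro term_fun_cong) (auto simp: Form_def y_def)
  ultimately show ?thesis
    using assms(1) by (auto simp: prov_equiv_def)
qed

lemma continuous_on_term_fun: "continuous_on S (term_fun p)"
proof (induction p)
  case (Var i)
  have "term_fun (Var i) = (\<lambda>x. x i)" by auto
  then show ?case
    using continuous_on_subset[OF continuous_on_product_coordinates subset_UNIV] by metis
next
  case (Neg p)
  have "term_fun (Neg p) = (\<lambda>x. 1 - term_fun p x)" by auto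
  with Neg show ?case by (auto intro!: continuous_intros)
next
  case (Imp p q)
  have "term_fun (p \<rightarrow>\<^sub>L q) = (\<lambda>x. min 1 (1 - term_fun p x + term_fun q x))" by auto
  with Imp show ?case by (auto intro!: continuous_intros)
next
  case (Nabla r p)
  have "term_fun (Nabla r p) = (\<lambda>x. 1 - Rep_unit_interval r * (1 - term_fun p x))" by auto
  with Nabla show ?case by (auto intro!: continuous_intros)
qed

lemma compact_cube: "compact (cube n)"
proof -
  \<comment> \<open>Tychonoff applies to the product over all of \<open>nat\<close>: the coordinates
    outside \<open>{1..n}\<close> range over a singleton, which is compact.\<close>
  have "cube n = Pi\<^sub>E UNIV (\<lambda>i. if i \<in> {1..n} then {0..1} else {undefined})"
    by (auto simp: cube_def PiE_def Pi_def extensional_def split: if_splits)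
  moreover have "compactin (product_topology (\<lambda>i. euclidean) (UNIV :: nat set))
      (Pi\<^sub>E UNIV (\<lambda>i. if i \<in> {1..n} then {0..1 :: real} else {undefined}))"
    by (simp add: compactin_PiE)
  ultimately show ?thesis
    by (simp add: euclidean_product_topology)
qed

section \<open>Completions of normed Riesz MV-algebras\<close>

text \<open>Describes the target of the embedding. The operations and the norm do not increase
  distances (for \<open>\<oplus>\<close>, the distances of the two arguments add up), so all of them
  commute with limits.\<close>

locale normed_riesz_mv_algebra = riesz_mv_algebra A
  for A :: "('a, 'm) normed_riesz_mv_scheme" (structure) +
  assumes mdist_nonneg: "\<lbrakk>x \<in> carr A; y \<in> carr A\<rbrakk> \<Longrightarrow> 0 \<le> mdist A x y"
    and mdist_eq_0: "\<lbrakk>x \<in> carr A; y \<in> carr A\<rbrakk> \<Longrightarrow> mdist A x y = 0 \<longleftrightarrow> x = y"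
    and mdist_commute: "\<lbrakk>x \<in> carr A; y \<in> carr A\<rbrakk> \<Longrightarrow> mdist A x y = mdist A y x"
    and mdist_triangle:
      "\<lbrakk>x \<in> carr A; y \<in> carr A; z \<in> carr A\<rbrakk> \<Longrightarrow> mdist A x z \<le> mdist A x y + mdist A y z"
    and mdist_oplus:
      "\<lbrakk>x \<in> carr A; x' \<in> carr A; y \<in> carr A; y' \<in> carr A\<rbrakk>
        \<Longrightarrow> mdist A (x \<oplus> y) (x' \<oplus> y') \<le> mdist A x x' + mdist A y y'"
    and mdist_neg: "\<lbrakk>x \<in> carr A; y \<in> carr A\<rbrakk> \<Longrightarrow> mdist A (\<sim> x) (\<sim> y) \<le> mdist A x y"
    and mdist_scal: "\<lbrakk>x \<in> carr A; y \<in> carr A\<rbrakk> \<Longrightarrow> mdist A (r \<cdot> x) (r \<cdot> y) \<le> mdist A x y"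
    and nrm_diff_le_mdist: "\<lbrakk>x \<in> carr A; y \<in> carr A\<rbrakk> \<Longrightarrow> \<bar>nrm A x - nrm A y\<bar> \<le> mdist A x y"

text \<open>All limits are taken in \<open>B\<close> and pulled back along \<open>F\<close>;
  \<open>A\<close> enters through closure under its operations, the isometric homomorphism
  \<open>F\<close> and the density of its image.\<close>

locale dense_isometric_embedding = B: normed_riesz_mv_algebra B
  for B :: "('b, 'k) normed_riesz_mv_scheme" +
  fixes A :: "('a, 'm) normed_riesz_mv_scheme" and F :: "'a \<Rightarrow> 'b"
  assumes complete:
      "s \<in> cauchy_seqs B \<Longrightarrow> \<exists>b\<in>carr B. (\<lambda>k. mdist B (s k) b) \<longlonglongrightarrow> 0"
    and A_zero_closed: "\<zero>\<^bsub>A\<^esub> \<in> carr A"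
    and A_oplus_closed: "\<lbrakk>x \<in> carr A; y \<in> carr A\<rbrakk> \<Longrightarrow> x \<oplus>\<^bsub>A\<^esub> y \<in> carr A"
    and A_neg_closed: "x \<in> carr A \<Longrightarrow> \<sim>\<^bsub>A\<^esub> x \<in> carr A"
    and A_scal_closed: "x \<in> carr A \<Longrightarrow> r \<cdot>\<^bsub>A\<^esub> x \<in> carr A"
    and F_closed: "x \<in> carr A \<Longrightarrow> F x \<in> carr B"
    and F_zero: "F \<zero>\<^bsub>A\<^esub> = \<zero>\<^bsub>B\<^esub>"
    and F_oplus: "\<lbrakk>x \<in> carr A; y \<in> carr A\<rbrakk> \<Longrightarrow> F (x \<oplus>\<^bsub>A\<^esub> y) = F x \<oplus>\<^bsub>B\<^esub> F y"
    and F_neg: "x \<in> carr A \<Longrightarrow> F (\<sim>\<^bsub>A\<^esub> x) = \<sim>\<^bsub>B\<^esub> (F x)"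
    and F_scal: "x \<in> carr A \<Longrightarrow> F (r \<cdot>\<^bsub>A\<^esub> x) = r \<cdot>\<^bsub>B\<^esub> F x"
    and F_nrm: "x \<in> carr A \<Longrightarrow> nrm B (F x) = nrm A x"
    and F_mdist: "\<lbrakk>x \<in> carr A; y \<in> carr A\<rbrakk> \<Longrightarrow> mdist B (F x) (F y) = mdist A x y"
    and F_dense: "\<lbrakk>b \<in> carr B; e > 0\<rbrakk> \<Longrightarrow> \<exists>x\<in>carr A. mdist B (F x) b < e"
begin

text \<open>By \<open>cauchy_rel_Image\<close> this is a single class of \<open>cauchy_rel A\<close>
  whenever \<open>b\<close> lies in \<open>B\<close>: the point of the completion that represents
  \<open>b\<close>.\<close>

definition seqs_to :: "'b \<Rightarrow> (nat \<Rightarrow> 'a) set" where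
  "seqs_to b = {s. (\<forall>k. s k \<in> carr A) \<and> (\<lambda>k. mdist B (F (s k)) b) \<longlonglongrightarrow> 0}"

lemma seqs_to_carr: "s \<in> seqs_to b \<Longrightarrow> s k \<in> carr A"
  by (simp add: seqs_to_def)

lemma seqs_toI:
  assumes "\<And>k. s k \<in> carr A" "b \<in> carr B"
    and "\<And>k. mdist B (F (s k)) b \<le> g k" "g \<longlonglongrightarrow> 0"
  shows "s \<in> seqs_to b"
proof -
  have "(\<lambda>k. mdist B (F (s k)) b) \<longlonglongrightarrow> 0"
    by (rule tendsto_sandwich[OF _ _ tendsto_const assms(4)])
      (auto intro!: always_eventually B.mdist_nonneg F_closed assms)
  with assms show ?thesis by (simp add: seqs_to_def)
qed

text \<open>Distances in \<open>A\<close> are distances of images in \<open>B\<close>, and a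
  distance changes by at most the sum of the displacements of its two end points.\<close>

lemma mdist_tendsto:
  assumes "b \<in> carr B" "c \<in> carr B" "s \<in> seqs_to b" "t \<in> seqs_to c"
  shows "(\<lambda>k. mdist A (s k) (t k)) \<longlonglongrightarrow> mdist B b c"
proof -
  have "\<bar>mdist A (s k) (t k) - mdist B b c\<bar> \<le> mdist B (F (s k)) b + mdist B (F (t k)) c" for k
  proof -
    have st: "s k \<in> carr A" "t k \<in> carr A" "F (s k) \<in> carr B" "F (t k) \<in> carr B"
      using assms F_closed seqs_to_carr by auto
    show ?thesis
      using B.mdist_triangle[of "F (s k)" b "F (t k)"] B.mdist_triangle[of b c "F (t k)"]
        B.mdist_triangle[of b "F (s k)" c] B.mdist_triangle[of "F (s k)" "F (t k)" c]
        B.mdist_commute[of b "F (s k)"] B.mdist_commute[of c "F (t k)"] st assms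
      by (simp add: F_mdist)
  qed
  note bound = this
  have lim: "(\<lambda>k. mdist B (F (s k)) b + mdist B (F (t k)) c) \<longlonglongrightarrow> 0"
    using assms by (intro tendsto_add_zero) (simp_all add: seqs_to_def)
  have "(\<lambda>k. mdist A (s k) (t k) - mdist B b c) \<longlonglongrightarrow> 0"
    by (rule Lim_null_comparison[OF _ lim]) (simp add: bound)
  then show ?thesis by (simp add: LIM_zero_iff)
qed

lemma nrm_tendsto:
  assumes "b \<in> carr B" "s \<in> seqs_to b"
  shows "(\<lambda>k. nrm A (s k)) \<longlonglongrightarrow> nrm B b"
proof -
  have "\<bar>nrm A (s k) - nrm B b\<bar> \<le> mdist B (F (s k)) b" for k
    using B.nrm_diff_le_mdist[of "F (s k)" b] assms F_closed seqs_to_carr F_nrm by auto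
  then have "\<forall>\<^sub>F k in sequentially. norm (nrm A (s k) - nrm B b) \<le> mdist B (F (s k)) b"
    by simp
  moreover have "(\<lambda>k. mdist B (F (s k)) b) \<longlonglongrightarrow> 0"
    using assms by (simp add: seqs_to_def)
  ultimately have "(\<lambda>k. nrm A (s k) - nrm B b) \<longlonglongrightarrow> 0"
    by (rule Lim_null_comparison)
  then show ?thesis by (simp add: LIM_zero_iff)
qed

lemma seqs_to_nonempty:
  assumes "b \<in> carr B"
  shows "seqs_to b \<noteq> {}"
proof -
  have "\<exists>x. x \<in> carr A \<and> mdist B (F x) b < 1 / Suc k" for k
    using F_dense[OF assms, of "1 / Suc k"] by auto
  then obtain s where s: "\<And>k. s k \<in> carr A \<and> mdist B (F (s k)) b < 1 / Suc k"
    by metis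
  have "s \<in> seqs_to b"
    using s assms by (intro seqs_toI[OF _ _ _ LIMSEQ_Suc[OF lim_1_over_n]]) (auto intro: less_imp_le)
  then show ?thesis by auto
qed

text \<open>The distances of \<open>s\<close> to itself are all 0, yet by
  \<open>mdist_tendsto\<close> they converge to the distance of \<open>b\<close> and
  \<open>c\<close>.\<close>

lemma seqs_to_unique:
  assumes "b \<in> carr B" "c \<in> carr B" "s \<in> seqs_to b" "s \<in> seqs_to c"
  shows "b = c"
proof -
  have "(\<lambda>k. mdist A (s k) (s k)) = (\<lambda>k. 0)"
    using assms(3) F_mdist B.mdist_eq_0 F_closed seqs_to_carr by (metis (no_types))
  with mdist_tendsto[OF assms] have "mdist B b c = 0"
    by (simp add: LIMSEQ_const_iff)
  with assms show ?thesis by (simp add: B.mdist_eq_0)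
qed

text \<open>Completeness of \<open>B\<close> enters here: \<open>F\<close> maps a Cauchy sequence of
  \<open>A\<close> to one of \<open>B\<close>, which has a limit. The converse is the triangle
  inequality through \<open>b\<close>.\<close>

lemma cauchy_seqs_eq: "cauchy_seqs A = (\<Union>b\<in>carr B. seqs_to b)"
proof (intro equalityI subsetI)
  fix s assume "s \<in> cauchy_seqs A"
  then have s: "\<And>k. s k \<in> carr A"
    and "\<forall>e>0. \<exists>N. \<forall>i\<ge>N. \<forall>j\<ge>N. mdist A (s i) (s j) < e"
    by (auto simp: cauchy_seqs_def)
  then have "(\<lambda>k. F (s k)) \<in> cauchy_seqs B"
    by (simp add: cauchy_seqs_def F_closed F_mdist)
  from complete[OF this] s show "s \<in> (\<Union>b\<in>carr B. seqs_to b)"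
    by (auto simp: seqs_to_def)
next
  fix s assume "s \<in> (\<Union>b\<in>carr B. seqs_to b)"
  then obtain b where b: "b \<in> carr B" "s \<in> seqs_to b" by auto
  have "\<exists>N. \<forall>i\<ge>N. \<forall>j\<ge>N. mdist A (s i) (s j) < e" if "e > 0" for e
  proof -
    from b(2) that have "\<forall>\<^sub>F k in sequentially. mdist B (F (s k)) b < e / 2"
      by (intro order_tendstoD(2)[of _ 0]) (auto simp: seqs_to_def)
    then obtain N where N: "\<And>k. k \<ge> N \<Longrightarrow> mdist B (F (s k)) b < e / 2"
      by (auto simp: eventually_sequentially)
    have "mdist A (s i) (s j) < e" if "i \<ge> N" "j \<ge> N" for i j
    proof -
      have "F (s i) \<in> carr B" "F (s j) \<in> carr B"
        using b F_closed seqs_to_carr by auto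
      with b show ?thesis
        using N[OF that(1)] N[OF that(2)] B.mdist_triangle[of "F (s i)" b "F (s j)"]
          B.mdist_commute[of b "F (s j)"] F_mdist seqs_to_carr by force
    qed
    then show ?thesis by auto
  qed
  with b show "s \<in> cauchy_seqs A" by (simp add: cauchy_seqs_def seqs_to_carr)
qed

text \<open>For sequences with limits \<open>b\<close> and \<open>c\<close> the distances tend to
  the distance of \<open>b\<close> and \<open>c\<close>, so the sequences are equivalent exactly
  when \<open>b = c\<close>.\<close>

lemma cauchy_rel_Image:
  assumes "b \<in> carr B" "s \<in> seqs_to b"
  shows "cauchy_rel A `` {s} = seqs_to b"
proof (intro equalityI subsetI)
  fix t assume "t \<in> cauchy_rel A `` {s}"
  then obtain c where c: "c \<in> carr B" "t \<in> seqs_to c"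
    and lim: "(\<lambda>k. mdist A (s k) (t k)) \<longlonglongrightarrow> 0"
    by (auto simp: cauchy_rel_def cauchy_seqs_eq)
  have "mdist B b c = 0"
    using LIMSEQ_unique[OF lim mdist_tendsto[OF assms(1) c(1) assms(2) c(2)]] by simp
  with assms c show "t \<in> seqs_to b" by (simp add: B.mdist_eq_0)
next
  fix t assume t: "t \<in> seqs_to b"
  have "mdist B b b = 0" using assms by (simp add: B.mdist_eq_0)
  with t assms mdist_tendsto[of b b s t] show "t \<in> cauchy_rel A `` {s}"
    by (auto simp: cauchy_rel_def cauchy_seqs_eq)
qed

section \<open>Operations on convergent sequences\<close>

lemma seqs_to_zero: "(\<lambda>k. \<zero>\<^bsub>A\<^esub>) \<in> seqs_to \<zero>\<^bsub>B\<^esub>"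
  using B.mdist_eq_0[OF B.zero_closed B.zero_closed]
  by (simp add: seqs_to_def A_zero_closed F_zero)

lemma seqs_to_oplus:
  assumes "b \<in> carr B" "c \<in> carr B" "s \<in> seqs_to b" "t \<in> seqs_to c"
  shows "(\<lambda>k. s k \<oplus>\<^bsub>A\<^esub> t k) \<in> seqs_to (b \<oplus>\<^bsub>B\<^esub> c)"
proof (rule seqs_toI[of _ _ "\<lambda>k. mdist B (F (s k)) b + mdist B (F (t k)) c"])
  show "(\<lambda>k. mdist B (F (s k)) b + mdist B (F (t k)) c) \<longlonglongrightarrow> 0"
    using assms by (intro tendsto_add_zero) (simp_all add: seqs_to_def)
qed (use assms in \<open>auto simp: A_oplus_closed B.oplus_closed F_oplus F_closed B.mdist_oplus seqs_to_carr\<close>)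

lemma seqs_to_neg:
  assumes "b \<in> carr B" "s \<in> seqs_to b"
  shows "(\<lambda>k. \<sim>\<^bsub>A\<^esub> (s k)) \<in> seqs_to (\<sim>\<^bsub>B\<^esub> b)"
  by (rule seqs_toI[of _ _ "\<lambda>k. mdist B (F (s k)) b"])
    (use assms seqs_to_def in \<open>auto simp: A_neg_closed B.neg_closed F_neg F_closed B.mdist_neg\<close>)

lemma seqs_to_scal:
  assumes "b \<in> carr B" "s \<in> seqs_to b"
  shows "(\<lambda>k. r \<cdot>\<^bsub>A\<^esub> s k) \<in> seqs_to (r \<cdot>\<^bsub>B\<^esub> b)"
  by (rule seqs_toI[of _ _ "\<lambda>k. mdist B (F (s k)) b"])
    (use assms seqs_to_def in \<open>auto simp: A_scal_closed B.scal_closed F_scal F_closed B.mdist_scal\<close>)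

lemma isometric_isomorphism_seqs_to: "isometric_isomorphism B (norm_completion A) seqs_to"
proof -
  have "bij_betw seqs_to (carr B) (carr (norm_completion A))"
  proof (rule bij_betw_imageI)
    show "inj_on seqs_to (carr B)"
      using seqs_to_unique seqs_to_nonempty by (metis equals0I inj_onI)
    have "cauchy_seqs A // cauchy_rel A = (\<Union>b\<in>carr B. \<Union>s\<in>seqs_to b. {seqs_to b})"
      unfolding quotient_def cauchy_seqs_eq by (auto simp: cauchy_rel_Image)
    also have "\<dots> = seqs_to ` carr B"
      using seqs_to_nonempty by fastforce
    finally show "seqs_to ` carr B = carr (norm_completion A)"
      by (simp add: norm_completion_def)
  qed
  moreover have "seqs_to \<zero>\<^bsub>B\<^esub> = \<zero>\<^bsub>norm_completion A\<^esub>"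
    using cauchy_rel_Image[OF B.zero_closed seqs_to_zero] by (simp add: norm_completion_def)
  moreover have "seqs_to (b \<oplus>\<^bsub>B\<^esub> c) = seqs_to b \<oplus>\<^bsub>norm_completion A\<^esub> seqs_to c"
    if "b \<in> carr B" "c \<in> carr B" for b c
  proof -
    \<comment> \<open>Every choice of representatives yields the same class, so the unions in the
      definition of the completion collapse to it; \<open>seqs_to_nonempty\<close> ensures that
      there is a representative.\<close>
    have "(\<Union>s\<in>seqs_to b. \<Union>t\<in>seqs_to c. cauchy_rel A `` {\<lambda>k. s k \<oplus>\<^bsub>A\<^esub> t k})
        = (\<Union>s\<in>seqs_to b. \<Union>t\<in>seqs_to c. seqs_to (b \<oplus>\<^bsub>B\<^esub> c))"
      using that by (intro SUP_cong refl cauchy_rel_Image seqs_to_oplus B.oplus_closed)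
    with that seqs_to_nonempty show ?thesis by (simp add: norm_completion_def)
  qed
  moreover have "seqs_to (\<sim>\<^bsub>B\<^esub> b) = \<sim>\<^bsub>norm_completion A\<^esub> (seqs_to b)" if "b \<in> carr B" for b
  proof -
    have "(\<Union>s\<in>seqs_to b. cauchy_rel A `` {\<lambda>k. \<sim>\<^bsub>A\<^esub> (s k)})
        = (\<Union>s\<in>seqs_to b. seqs_to (\<sim>\<^bsub>B\<^esub> b))"
      using that by (intro SUP_cong refl cauchy_rel_Image seqs_to_neg B.neg_closed)
    with that seqs_to_nonempty show ?thesis by (simp add: norm_completion_def)
  qed
  moreover have "seqs_to (r \<cdot>\<^bsub>B\<^esub> b) = r \<cdot>\<^bsub>norm_completion A\<^esub> seqs_to b" if "b \<in> carr B" for r b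
  proof -
    have "(\<Union>s\<in>seqs_to b. cauchy_rel A `` {\<lambda>k. r \<cdot>\<^bsub>A\<^esub> s k})
        = (\<Union>s\<in>seqs_to b. seqs_to (r \<cdot>\<^bsub>B\<^esub> b))"
      using that by (intro SUP_cong refl cauchy_rel_Image seqs_to_scal B.scal_closed)
    with that seqs_to_nonempty show ?thesis by (simp add: norm_completion_def)
  qed
  moreover have "nrm (norm_completion A) (seqs_to b) = nrm B b" if "b \<in> carr B" for b
  proof -
    \<comment> \<open>All representatives give the same limit, so \<open>the_elem\<close> is applied
      to a singleton.\<close>
    have "(\<lambda>s. lim (\<lambda>k. nrm A (s k))) ` seqs_to b = (\<lambda>s. nrm B b) ` seqs_to b"
      using that by (intro image_cong refl limI nrm_tendsto)
    with seqs_to_nonempty[OF that] show ?thesis by (simp add: norm_completion_def image_constant_conv)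
  qed
  moreover have "mdist (norm_completion A) (seqs_to b) (seqs_to c) = mdist B b c"
    if "b \<in> carr B" "c \<in> carr B" for b c
  proof -
    have "(\<lambda>(s, t). lim (\<lambda>k. mdist A (s k) (t k))) ` (seqs_to b \<times> seqs_to c)
        = (\<lambda>_. mdist B b c) ` (seqs_to b \<times> seqs_to c)"
      using that by (intro image_cong refl) (auto intro!: limI mdist_tendsto)
    with seqs_to_nonempty that show ?thesis
      by (simp add: norm_completion_def image_constant_conv)
  qed
  ultimately show ?thesis
    unfolding isometric_isomorphism_def by blast
qed

end

section \<open>Transport along isometric isomorphisms\<close>

lemma isometric_isomorphism_inv:
  assumes h: "isometric_isomorphism B A h" and B: "riesz_mv_algebra B"
  shows "isometric_isomorphism A B (the_inv_into (carr B) h)"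
proof -
  interpret B: riesz_mv_algebra B by (rule B)
  have bij: "bij_betw h (carr B) (carr A)"
    using h by (simp add: isometric_isomorphism_def)
  then have A: "carr A = h ` carr B" and inv: "\<And>x. x \<in> carr B \<Longrightarrow> the_inv_into (carr B) h (h x) = x"
    by (auto simp: bij_betw_def the_inv_into_f_f)
  have hom: "\<zero>\<^bsub>A\<^esub> = h \<zero>\<^bsub>B\<^esub>"
    "\<And>x y. x \<in> carr B \<Longrightarrow> y \<in> carr B \<Longrightarrow> h x \<oplus>\<^bsub>A\<^esub> h y = h (x \<oplus>\<^bsub>B\<^esub> y)"
    "\<And>x. x \<in> carr B \<Longrightarrow> \<sim>\<^bsub>A\<^esub> (h x) = h (\<sim>\<^bsub>B\<^esub> x)"
    "\<And>r x. x \<in> carr B \<Longrightarrow> r \<cdot>\<^bsub>A\<^esub> h x = h (r \<cdot>\<^bsub>B\<^esub> x)"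
    "\<And>x. x \<in> carr B \<Longrightarrow> nrm A (h x) = nrm B x"
    "\<And>x y. x \<in> carr B \<Longrightarrow> y \<in> carr B \<Longrightarrow> mdist A (h x) (h y) = mdist B x y"
    using h by (simp_all add: isometric_isomorphism_def)
  show ?thesis
    unfolding isometric_isomorphism_def
    using bij_betw_the_inv_into[OF bij]
    by (simp add: A hom inv B.zero_closed B.oplus_closed B.neg_closed B.scal_closed)
qed

text \<open>Gives the algebraic laws of the completion without computing with Cauchy sequences: each
  element of \<open>A\<close> is some \<open>h x\<close>, and \<open>h\<close> carries over every
  equation of \<open>B\<close>.\<close>

lemma riesz_mv_algebra_isometric_isomorphism:
  assumes h: "isometric_isomorphism B A h" and B: "riesz_mv_algebra B"
  shows "riesz_mv_algebra A"
proof -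
  interpret B: riesz_mv_algebra B by (rule B)
  have A: "carr A = h ` carr B"
    using h by (simp add: isometric_isomorphism_def bij_betw_def)
  have zero: "\<zero>\<^bsub>A\<^esub> = h \<zero>\<^bsub>B\<^esub>"
    and oplus: "\<And>x y. x \<in> carr B \<Longrightarrow> y \<in> carr B \<Longrightarrow> h x \<oplus>\<^bsub>A\<^esub> h y = h (x \<oplus>\<^bsub>B\<^esub> y)"
    and neg: "\<And>x. x \<in> carr B \<Longrightarrow> \<sim>\<^bsub>A\<^esub> (h x) = h (\<sim>\<^bsub>B\<^esub> x)"
    and scal: "\<And>r x. x \<in> carr B \<Longrightarrow> r \<cdot>\<^bsub>A\<^esub> h x = h (r \<cdot>\<^bsub>B\<^esub> x)"
    using h by (simp_all add: isometric_isomorphism_def)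
  have odot_closed: "x \<odot>\<^bsub>B\<^esub> y \<in> carr B"
    and odot: "h x \<odot>\<^bsub>A\<^esub> h y = h (x \<odot>\<^bsub>B\<^esub> y)" if "x \<in> carr B" "y \<in> carr B" for x y
    using that by (simp_all add: odot_def neg oplus B.neg_closed B.oplus_closed)
  show ?thesis
  proof
    show "x \<oplus>\<^bsub>A\<^esub> y = y \<oplus>\<^bsub>A\<^esub> x" if "x \<in> carr A" "y \<in> carr A" for x y
      using that by (auto simp: A oplus B.oplus_commute)
    show "\<sim>\<^bsub>A\<^esub> (\<sim>\<^bsub>A\<^esub> x \<oplus>\<^bsub>A\<^esub> y) \<oplus>\<^bsub>A\<^esub> y = \<sim>\<^bsub>A\<^esub> (\<sim>\<^bsub>A\<^esub> y \<oplus>\<^bsub>A\<^esub> x) \<oplus>\<^bsub>A\<^esub> x"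
      if "x \<in> carr A" "y \<in> carr A" for x y
    proof -
      from that obtain a b where "x = h a" "y = h b" "a \<in> carr B" "b \<in> carr B"
        by (auto simp: A)
      then show ?thesis
        using B.mangani[of a b] by (simp add: oplus neg B.oplus_closed B.neg_closed)
    qed
  qed (auto simp: A zero oplus neg scal odot B.zero_closed B.oplus_closed B.neg_closed
      B.scal_closed odot_closed B.oplus_assoc B.oplus_zero B.neg_neg
      B.one_absorb B.scal_odot B.minus_scal B.scal_scal B.one_scal)
qed

section \<open>The algebra of continuous functions\<close>

lemma C_cube_simps:
  "carr (C_cube n) = {f \<in> cube n \<rightarrow>\<^sub>E {0..1}. continuous_on (cube n) f}"
  "\<zero>\<^bsub>C_cube n\<^esub> = (\<lambda>x\<in>cube n. 0)"
  "f \<oplus>\<^bsub>C_cube n\<^esub> g = (\<lambda>x\<in>cube n. min 1 (f x + g x))"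
  "\<sim>\<^bsub>C_cube n\<^esub> f = (\<lambda>x\<in>cube n. 1 - f x)"
  "r \<cdot>\<^bsub>C_cube n\<^esub> f = (\<lambda>x\<in>cube n. Rep_unit_interval r * f x)"
  "nrm (C_cube n) f = (SUP x\<in>cube n. \<bar>f x\<bar>)"
  "mdist (C_cube n) f g = (SUP x\<in>cube n. \<bar>f x - g x\<bar>)"
  by (simp_all add: C_cube_def)

text \<open>The scalar axioms involving \<open>\<odot>\<close> are checked in this form, where they
  are distributivity over \<open>max\<close>.\<close>

lemma C_cube_odot_neg:
  "f \<odot>\<^bsub>C_cube n\<^esub> \<sim>\<^bsub>C_cube n\<^esub> g = (\<lambda>x\<in>cube n. max 0 (f x - g x))"
  by (auto simp: odot_def C_cube_simps fun_eq_iff restrict_def min_def max_def)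

lemma C_cube_bounds:
  "f \<in> carr (C_cube n) \<Longrightarrow> x \<in> cube n \<Longrightarrow> 0 \<le> f x \<and> f x \<le> 1"
  by (auto simp: C_cube_simps PiE_iff)

lemma C_cube_eqI:
  assumes "f \<in> carr (C_cube n)" "g \<in> carr (C_cube n)" "\<And>x. x \<in> cube n \<Longrightarrow> f x = g x"
  shows "f = g"
  using assms by (auto simp: C_cube_simps intro: PiE_ext)

lemma restrict_in_C_cube:
  assumes "continuous_on (cube n) f" "\<And>x. x \<in> cube n \<Longrightarrow> f x \<in> {0..1}"
  shows "restrict f (cube n) \<in> carr (C_cube n)"
  using assms by (auto simp: C_cube_simps cong: continuous_on_cong)

lemma C_cube_continuous: "f \<in> carr (C_cube n) \<Longrightarrow> continuous_on (cube n) f"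
  by (simp add: C_cube_simps)

lemma C_cube_closed:
  "\<zero>\<^bsub>C_cube n\<^esub> \<in> carr (C_cube n)"
  "\<lbrakk>f \<in> carr (C_cube n); g \<in> carr (C_cube n)\<rbrakk> \<Longrightarrow> f \<oplus>\<^bsub>C_cube n\<^esub> g \<in> carr (C_cube n)"
  "f \<in> carr (C_cube n) \<Longrightarrow> \<sim>\<^bsub>C_cube n\<^esub> f \<in> carr (C_cube n)"
  "f \<in> carr (C_cube n) \<Longrightarrow> r \<cdot>\<^bsub>C_cube n\<^esub> f \<in> carr (C_cube n)"
proof -
  show "\<zero>\<^bsub>C_cube n\<^esub> \<in> carr (C_cube n)"
    unfolding C_cube_simps(2) by (rule restrict_in_C_cube) auto
  assume f: "f \<in> carr (C_cube n)"
  note f_cont = C_cube_continuous[OF f] and f_bounds = C_cube_bounds[OF f]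
  show "\<sim>\<^bsub>C_cube n\<^esub> f \<in> carr (C_cube n)"
    unfolding C_cube_simps(4)
    by (rule restrict_in_C_cube) (auto intro!: continuous_on_diff f_cont simp: f_bounds)
  show "r \<cdot>\<^bsub>C_cube n\<^esub> f \<in> carr (C_cube n)"
    unfolding C_cube_simps(5)
    by (rule restrict_in_C_cube)
      (auto intro!: continuous_on_mult f_cont mult_le_one simp: f_bounds Rep_ui_bounds)
  assume g: "g \<in> carr (C_cube n)"
  show "f \<oplus>\<^bsub>C_cube n\<^esub> g \<in> carr (C_cube n)"
    unfolding C_cube_simps(3)
    by (rule restrict_in_C_cube)
      (auto intro!: continuous_on_min continuous_on_add f_cont C_cube_continuous[OF g]
        simp: f_bounds C_cube_bounds[OF g])
qed

lemma riesz_mv_algebra_C_cube: "riesz_mv_algebra (C_cube n)"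
proof
  fix f g h r q
  let ?C = "carr (C_cube n)"
  show "\<zero>\<^bsub>C_cube n\<^esub> \<in> ?C" by (rule C_cube_closed)
  assume f: "f \<in> ?C"
  note fb = C_cube_bounds[OF f]
  show "\<sim>\<^bsub>C_cube n\<^esub> f \<in> ?C" "r \<cdot>\<^bsub>C_cube n\<^esub> f \<in> ?C"
    using f by (auto intro: C_cube_closed)
  have ext: "f' = f" if "\<And>x. x \<in> cube n \<Longrightarrow> f' x = f x" "f' \<in> ?C" for f'
    using C_cube_eqI[OF that(2) f that(1)] .
  show "f \<oplus>\<^bsub>C_cube n\<^esub> \<zero>\<^bsub>C_cube n\<^esub> = f"
    by (rule ext) (simp add: C_cube_simps fb, intro C_cube_closed f)
  show "\<sim>\<^bsub>C_cube n\<^esub> (\<sim>\<^bsub>C_cube n\<^esub> f) = f"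
    by (rule ext) (simp add: C_cube_simps, intro C_cube_closed f)
  show "\<sim>\<^bsub>C_cube n\<^esub> \<zero>\<^bsub>C_cube n\<^esub> \<oplus>\<^bsub>C_cube n\<^esub> f = \<sim>\<^bsub>C_cube n\<^esub> \<zero>\<^bsub>C_cube n\<^esub>"
    using fb by (auto simp: C_cube_simps intro!: restrict_ext)
  show "ui_minus r q \<cdot>\<^bsub>C_cube n\<^esub> f = (r \<cdot>\<^bsub>C_cube n\<^esub> f) \<odot>\<^bsub>C_cube n\<^esub> \<sim>\<^bsub>C_cube n\<^esub> (q \<cdot>\<^bsub>C_cube n\<^esub> f)"
    unfolding C_cube_odot_neg
    using fb by (auto simp: C_cube_simps Rep_ui_minus max_mult_distrib_right left_diff_distrib intro!: restrict_ext)
  show "r \<cdot>\<^bsub>C_cube n\<^esub> (q \<cdot>\<^bsub>C_cube n\<^esub> f) = ui_mult r q \<cdot>\<^bsub>C_cube n\<^esub> f"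
    by (auto simp: C_cube_simps Rep_ui_mult intro!: restrict_ext)
  show "ui_one \<cdot>\<^bsub>C_cube n\<^esub> f = f"
    by (rule ext) (simp add: C_cube_simps Rep_ui_one, intro C_cube_closed f)
  assume g: "g \<in> ?C"
  note gb = C_cube_bounds[OF g]
  show "f \<oplus>\<^bsub>C_cube n\<^esub> g \<in> ?C"
    using f g by (rule C_cube_closed)
  show "f \<oplus>\<^bsub>C_cube n\<^esub> g = g \<oplus>\<^bsub>C_cube n\<^esub> f"
    by (simp add: C_cube_simps add.commute)
  show "\<sim>\<^bsub>C_cube n\<^esub> (\<sim>\<^bsub>C_cube n\<^esub> f \<oplus>\<^bsub>C_cube n\<^esub> g) \<oplus>\<^bsub>C_cube n\<^esub> g
      = \<sim>\<^bsub>C_cube n\<^esub> (\<sim>\<^bsub>C_cube n\<^esub> g \<oplus>\<^bsub>C_cube n\<^esub> f) \<oplus>\<^bsub>C_cube n\<^esub> f"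
    using fb gb by (auto simp: C_cube_simps min_def intro!: restrict_ext)
  show "r \<cdot>\<^bsub>C_cube n\<^esub> (f \<odot>\<^bsub>C_cube n\<^esub> \<sim>\<^bsub>C_cube n\<^esub> g)
      = (r \<cdot>\<^bsub>C_cube n\<^esub> f) \<odot>\<^bsub>C_cube n\<^esub> \<sim>\<^bsub>C_cube n\<^esub> (r \<cdot>\<^bsub>C_cube n\<^esub> g)"
    unfolding C_cube_odot_neg
    by (auto simp: C_cube_simps Rep_ui_bounds max_mult_distrib_left right_diff_distrib intro!: restrict_ext)
  assume h: "h \<in> ?C"
  note hb = C_cube_bounds[OF h]
  show "(f \<oplus>\<^bsub>C_cube n\<^esub> g) \<oplus>\<^bsub>C_cube n\<^esub> h = f \<oplus>\<^bsub>C_cube n\<^esub> (g \<oplus>\<^bsub>C_cube n\<^esub> h)"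
  proof -
    have "min 1 (min 1 (f x + g x) + h x) = min 1 (f x + min 1 (g x + h x))" if "x \<in> cube n" for x
      using fb[OF that] gb[OF that] hb[OF that] by (simp add: min_def)
    then show ?thesis by (auto simp: C_cube_simps intro!: restrict_ext)
  qed
qed

text \<open>A real \<open>SUP\<close> is a least upper bound only for nonempty bounded sets. The
  cube is nonempty, and functions with values in [0,1] differ by at most 1.\<close>

lemma C_cube_mdist_le_iff:
  assumes "f \<in> carr (C_cube n)" "g \<in> carr (C_cube n)"
  shows "mdist (C_cube n) f g \<le> c \<longleftrightarrow> (\<forall>x\<in>cube n. \<bar>f x - g x\<bar> \<le> c)"
proof -
  have "bdd_above ((\<lambda>x. \<bar>f x - g x\<bar>) ` cube n)"
    using C_cube_bounds[OF assms(1)] C_cube_bounds[OF assms(2)]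
    by (intro bdd_aboveI2[where M = 1]) fastforce
  then show ?thesis
    unfolding C_cube_simps by (rule cSUP_le_iff[OF cube_nonempty])
qed

lemma C_cube_diff_le_mdist:
  assumes "f \<in> carr (C_cube n)" "g \<in> carr (C_cube n)" "x \<in> cube n"
  shows "\<bar>f x - g x\<bar> \<le> mdist (C_cube n) f g"
  using C_cube_mdist_le_iff[OF assms(1,2), of "mdist (C_cube n) f g"] assms(3) by simp

text \<open>Reduces the Lipschitz bound for the norm to the triangle inequality.\<close>

lemma C_cube_nrm_eq_mdist: "nrm (C_cube n) f = mdist (C_cube n) f \<zero>\<^bsub>C_cube n\<^esub>"
  unfolding C_cube_simps by (intro SUP_cong) auto

lemma normed_riesz_mv_algebra_C_cube: "normed_riesz_mv_algebra (C_cube n)"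
proof -
  interpret riesz_mv_algebra "C_cube n" by (rule riesz_mv_algebra_C_cube)
  let ?C = "carr (C_cube n)" and ?d = "mdist (C_cube n)"
  have nonneg: "0 \<le> ?d f g" if "f \<in> ?C" "g \<in> ?C" for f g
    using C_cube_diff_le_mdist[OF that] cube_nonempty[of n] by fastforce
  have commute: "?d f g = ?d g f" for f g
    by (simp add: C_cube_simps abs_minus_commute)
  have triangle: "?d f h \<le> ?d f g + ?d g h" if "f \<in> ?C" "g \<in> ?C" "h \<in> ?C" for f g h
    using C_cube_diff_le_mdist[OF that(1,2)] C_cube_diff_le_mdist[OF that(2,3)]
    by (subst C_cube_mdist_le_iff) (use that in \<open>fastforce+\<close>)
  show ?thesis
  proof
    fix f g assume fg: "f \<in> ?C" "g \<in> ?C"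
    note le = C_cube_diff_le_mdist[OF fg]
    show "0 \<le> ?d f g" using fg by (rule nonneg)
    show "?d f g = ?d g f" by (rule commute)
    show "?d f g = 0 \<longleftrightarrow> f = g"
    proof
      assume "?d f g = 0"
      with le have "f x = g x" if "x \<in> cube n" for x using that by fastforce
      with fg show "f = g" by (rule C_cube_eqI)
    next
      assume "f = g"
      with C_cube_mdist_le_iff[OF fg, of 0] nonneg[OF fg] show "?d f g = 0" by simp
    qed
    show "?d (\<sim>\<^bsub>C_cube n\<^esub> f) (\<sim>\<^bsub>C_cube n\<^esub> g) \<le> ?d f g"
      unfolding C_cube_mdist_le_iff[OF neg_closed[OF fg(1)] neg_closed[OF fg(2)]]
      using le by (simp add: C_cube_simps(4) abs_minus_commute)
    show "?d (r \<cdot>\<^bsub>C_cube n\<^esub> f) (r \<cdot>\<^bsub>C_cube n\<^esub> g) \<le> ?d f g" for r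
    proof -
      have "\<bar>Rep_unit_interval r * f x - Rep_unit_interval r * g x\<bar> \<le> ?d f g"
        if "x \<in> cube n" for x
      proof -
        have "Rep_unit_interval r * \<bar>f x - g x\<bar> \<le> 1 * \<bar>f x - g x\<bar>"
          by (intro mult_right_mono) (simp_all add: Rep_ui_bounds)
        with le[OF that] show ?thesis
          by (simp add: abs_mult Rep_ui_bounds flip: right_diff_distrib)
      qed
      then show ?thesis
        unfolding C_cube_mdist_le_iff[OF scal_closed[OF fg(1)] scal_closed[OF fg(2)]]
        by (simp add: C_cube_simps(5))
    qed
    show "\<bar>nrm (C_cube n) f - nrm (C_cube n) g\<bar> \<le> ?d f g"
      unfolding C_cube_nrm_eq_mdist
      using triangle[OF fg zero_closed] triangle[OF fg(2,1) zero_closed] commute[of f g] by linarith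
  next
    fix f g h assume "f \<in> ?C" "g \<in> ?C" "h \<in> ?C"
    then show "?d f h \<le> ?d f g + ?d g h" by (rule triangle)
  next
    fix f f' g g' assume *: "f \<in> ?C" "f' \<in> ?C" "g \<in> ?C" "g' \<in> ?C"
    have "\<bar>min 1 (f x + g x) - min 1 (f' x + g' x)\<bar> \<le> ?d f f' + ?d g g'" if "x \<in> cube n" for x
      using C_cube_diff_le_mdist[OF *(1,2) that] C_cube_diff_le_mdist[OF *(3,4) that] by linarith
    then show "?d (f \<oplus>\<^bsub>C_cube n\<^esub> g) (f' \<oplus>\<^bsub>C_cube n\<^esub> g') \<le> ?d f f' + ?d g g'"
      unfolding C_cube_mdist_le_iff[OF oplus_closed[OF *(1,3)] oplus_closed[OF *(2,4)]]
      by (simp add: C_cube_simps(3))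
  qed
qed

text \<open>A Cauchy sequence for the sup metric is uniformly Cauchy, and its uniform limit is again
  continuous with values in [0,1].\<close>

lemma C_cube_complete:
  assumes "s \<in> cauchy_seqs (C_cube n)"
  shows "\<exists>f\<in>carr (C_cube n). (\<lambda>k. mdist (C_cube n) (s k) f) \<longlonglongrightarrow> 0"
proof -
  have s: "\<And>k. s k \<in> carr (C_cube n)"
    and cauchy: "\<And>e. e > 0 \<Longrightarrow> \<exists>N. \<forall>i\<ge>N. \<forall>j\<ge>N. mdist (C_cube n) (s i) (s j) < e"
    using assms by (auto simp: cauchy_seqs_def)
  have "uniformly_Cauchy_on (cube n) s"
  proof (rule uniformly_Cauchy_onI)
    fix e :: real assume "e > 0"
    then obtain N where N: "\<And>i j. i \<ge> N \<Longrightarrow> j \<ge> N \<Longrightarrow> mdist (C_cube n) (s i) (s j) < e"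
      using cauchy by blast
    have "dist (s i x) (s j x) < e" if "x \<in> cube n" "i \<ge> N" "j \<ge> N" for x i j
      using C_cube_diff_le_mdist[OF s s that(1), of i j] N[OF that(2,3)] by (simp add: dist_real_def)
    then show "\<exists>M. \<forall>x\<in>cube n. \<forall>m\<ge>M. \<forall>n\<ge>M. dist (s m x) (s n x) < e" by blast
  qed
  then obtain l where l: "uniform_limit (cube n) s l sequentially"
    using Cauchy_uniformly_convergent by (auto simp: uniformly_convergent_on_def)
  let ?f = "restrict l (cube n)"
  have "continuous_on (cube n) l"
    by (rule uniform_limit_theorem[OF _ l]) (simp_all add: C_cube_continuous s)
  moreover have "l x \<in> {0..1}" if "x \<in> cube n" for x
    using tendsto_uniform_limitI[OF l that] C_cube_bounds[OF s that]
    by (auto intro: LIMSEQ_le_const LIMSEQ_le_const2)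
  ultimately have f: "?f \<in> carr (C_cube n)"
    by (rule restrict_in_C_cube)
  have "(\<lambda>k. mdist (C_cube n) (s k) ?f) \<longlonglongrightarrow> 0"
  proof (rule tendstoI)
    fix e :: real assume "e > 0"
    then have "\<forall>\<^sub>F k in sequentially. \<forall>x\<in>cube n. dist (s k x) (l x) < e / 2"
      by (intro uniform_limitD[OF l]) simp
    then show "\<forall>\<^sub>F k in sequentially. dist (mdist (C_cube n) (s k) ?f) 0 < e"
    proof eventually_elim
      case (elim k)
      \<comment> \<open>Strict pointwise bounds yield only a weak bound on the supremum, hence the
        use of \<open>e / 2\<close>.\<close>
      have "mdist (C_cube n) (s k) ?f \<le> e / 2"
        unfolding C_cube_mdist_le_iff[OF s f] using elim by (force simp: dist_real_def)
      with \<open>e > 0\<close> normed_riesz_mv_algebra.mdist_nonneg[OF normed_riesz_mv_algebra_C_cube s f]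
      show ?case by (simp add: dist_real_def)
    qed
  qed
  with f show ?thesis by blast
qed

section \<open>Density of term functions\<close>

text \<open>The sets where some \<open>g\<close> in \<open>L\<close> lies below \<open>f\<close> are
  relatively open and cover \<open>K\<close>. A finite subcover and directedness give one function
  below finitely many of them, hence below \<open>f\<close> everywhere.\<close>

lemma min_directed_exists_below:
  fixes f :: "'a::topological_space \<Rightarrow> real"
  assumes "compact K" "K \<noteq> {}" and f: "continuous_on K f"
    and L: "\<And>g. g \<in> L \<Longrightarrow> continuous_on K g"
    and directed: "\<And>g h. g \<in> L \<Longrightarrow> h \<in> L \<Longrightarrow> \<exists>k\<in>L. \<forall>x\<in>K. k x \<le> g x \<and> k x \<le> h x"
    and below: "\<And>x. x \<in> K \<Longrightarrow> \<exists>g\<in>L. g x < f x"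
  shows "\<exists>g\<in>L. \<forall>x\<in>K. g x < f x"
proof -
  have "\<exists>U. open U \<and> U \<inter> K = {x\<in>K. g x < f x}" if "g \<in> L" for g
  proof -
    have "continuous_on K (\<lambda>x. f x - g x)"
      using f L[OF that] by (rule continuous_on_diff)
    then obtain U where "open U" "U \<inter> K = (\<lambda>x. f x - g x) -` {0<..} \<inter> K"
      using continuous_on_open_invariant open_greaterThan by metis
    moreover have "(\<lambda>x. f x - g x) -` {0<..} \<inter> K = {x\<in>K. g x < f x}" by auto
    ultimately show ?thesis by blast
  qed
  then obtain U where U: "\<And>g. g \<in> L \<Longrightarrow> open (U g) \<and> U g \<inter> K = {x\<in>K. g x < f x}"
    by metis
  have "K \<subseteq> (\<Union>g\<in>L. U g)"
    using U below by blast
  then obtain L' where L': "L' \<subseteq> L" "finite L'" "K \<subseteq> (\<Union>g\<in>L'. U g)"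
    using compactE_image[OF \<open>compact K\<close>, of L U] U by blast
  have "L' \<noteq> {}" using L' \<open>K \<noteq> {}\<close> by auto
  from L'(2) this L'(1) have "\<exists>h\<in>L. \<forall>g\<in>L'. \<forall>x\<in>K. h x \<le> g x"
  proof (induction L' rule: finite_ne_induct)
    case (singleton g)
    then show ?case by auto
  next
    case (insert g L')
    then obtain h where "h \<in> L" "\<forall>g\<in>L'. \<forall>x\<in>K. h x \<le> g x" by auto
    moreover from this insert directed[of g h] obtain k
      where "k \<in> L" "\<forall>x\<in>K. k x \<le> g x \<and> k x \<le> h x" by auto
    ultimately show ?case by (intro bexI[of _ k]) force+
  qed
  then obtain h where h: "h \<in> L" "\<And>g x. g \<in> L' \<Longrightarrow> x \<in> K \<Longrightarrow> h x \<le> g x" by blast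
  have "h x < f x" if x: "x \<in> K" for x
  proof -
    obtain g where "g \<in> L'" "x \<in> U g" using L' x by blast
    then have "g x < f x" using U[of g] L' x by blast
    with h(2)[OF \<open>g \<in> L'\<close> x] show ?thesis by simp
  qed
  with h show ?thesis by blast
qed

text \<open>Two compactness arguments. For fixed \<open>x\<close>, minima of functions agreeing with
  \<open>f\<close> at \<open>x\<close> get below \<open>f + e\<close> on all of \<open>K\<close> and
  keep the value at \<open>x\<close>. Maxima of the resulting functions over varying
  \<open>x\<close> then also get above \<open>f - e\<close>.\<close>

lemma lattice_Stone_Weierstrass:
  fixes f :: "'a::topological_space \<Rightarrow> real"
  assumes K: "compact K" "K \<noteq> {}" and f: "continuous_on K f" and "e > 0"
    and L: "\<And>g. g \<in> L \<Longrightarrow> continuous_on K g"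
    and min: "\<And>g h. g \<in> L \<Longrightarrow> h \<in> L \<Longrightarrow> \<exists>k\<in>L. \<forall>x\<in>K. k x = min (g x) (h x)"
    and max: "\<And>g h. g \<in> L \<Longrightarrow> h \<in> L \<Longrightarrow> \<exists>k\<in>L. \<forall>x\<in>K. k x = max (g x) (h x)"
    and interpolate: "\<And>x y. x \<in> K \<Longrightarrow> y \<in> K \<Longrightarrow> \<exists>g\<in>L. g x = f x \<and> g y = f y"
  shows "\<exists>g\<in>L. \<forall>x\<in>K. \<bar>g x - f x\<bar> < e"
proof -
  have upper: "\<exists>g\<in>L. g x = f x \<and> (\<forall>y\<in>K. g y < f y + e)" if x: "x \<in> K" for x
  proof -
    have "\<exists>g\<in>{g\<in>L. g x = f x}. \<forall>y\<in>K. g y < f y + e"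
    proof (rule min_directed_exists_below[OF K])
      show "continuous_on K (\<lambda>y. f y + e)" using f by (intro continuous_intros)
      fix g h assume "g \<in> {g\<in>L. g x = f x}" "h \<in> {g\<in>L. g x = f x}"
      with min[of g h] x show "\<exists>k\<in>{g\<in>L. g x = f x}. \<forall>y\<in>K. k y \<le> g y \<and> k y \<le> h y" by fastforce
    next
      fix y assume "y \<in> K"
      from interpolate[OF x this] \<open>e > 0\<close> show "\<exists>g\<in>{g\<in>L. g x = f x}. g y < f y + e" by force
    qed (use L in auto)
    then show ?thesis by blast
  qed
  let ?L = "{g\<in>L. \<forall>y\<in>K. g y < f y + e}"
  \<comment> \<open>Negation turns maxima into minima, so the lemma on minima serves again:
    \<open>- g x < e - f x\<close> is the lower estimate for \<open>g\<close>.\<close>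
  have "\<exists>g\<in>(\<lambda>g x. - g x) ` ?L. \<forall>x\<in>K. g x < e - f x"
  proof (rule min_directed_exists_below[OF K])
    show "continuous_on K (\<lambda>x. e - f x)" using f by (intro continuous_intros)
    show "continuous_on K g" if "g \<in> (\<lambda>g x. - g x) ` ?L" for g
      using that L by (auto intro!: continuous_intros)
    show "\<exists>k\<in>(\<lambda>g x. - g x) ` ?L. \<forall>x\<in>K. k x \<le> g x \<and> k x \<le> h x"
      if "g \<in> (\<lambda>g x. - g x) ` ?L" "h \<in> (\<lambda>g x. - g x) ` ?L" for g h
    proof -
      obtain g' h' where gh: "g' \<in> ?L" "h' \<in> ?L" "g = (\<lambda>x. - g' x)" "h = (\<lambda>x. - h' x)"
        using \<open>g \<in> _\<close> \<open>h \<in> _\<close> by blast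
      then obtain k where k: "k \<in> L" "\<forall>x\<in>K. k x = max (g' x) (h' x)"
        using max[of g' h'] by auto
      with gh have "k \<in> ?L" by simp
      then show ?thesis using k gh by (intro bexI[of _ "\<lambda>x. - k x"]) auto
    qed
    show "\<exists>g\<in>(\<lambda>g x. - g x) ` ?L. g x < e - f x" if "x \<in> K" for x
    proof -
      from upper[OF that] obtain g where "g \<in> ?L" "g x = f x" by blast
      then show ?thesis using \<open>e > 0\<close> by (intro bexI[of _ "\<lambda>x. - g x"]) auto
    qed
  qed
  then show ?thesis by (force simp: abs_less_iff)
qed

section \<open>Interpolation by term functions\<close>

lemma Rep_ui_cases: "a \<in> {0..1} \<Longrightarrow> \<exists>r. Rep_unit_interval r = a"
  by (metis Abs_unit_interval_inverse)

text \<open>The language has no constants; scaling a tautology by \<open>a\<close> supplies them,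
  and \<open>n \<ge> 1\<close> provides the variable to write it with.\<close>

lemma term_fun_const:
  assumes "n \<ge> 1" "a \<in> {0..1}"
  shows "\<exists>p\<in>Form n. \<forall>x. term_fun p x = a"
proof -
  obtain r where "Rep_unit_interval r = a" using Rep_ui_cases[OF assms(2)] ..
  with assms(1) show ?thesis
    by (intro bexI[of _ "Delta r (Var 1 \<rightarrow>\<^sub>L Var 1)"]) (auto simp: term_fun_Delta)
qed

text \<open>\<open>Neg p \<rightarrow>\<^sub>L q\<close> is the truncated sum of \<open>p\<close>
  and \<open>q\<close>. Iterating it produces arbitrarily steep functions although all scalars are
  at most 1.\<close>

lemma term_fun_multiple:
  assumes "n \<ge> 1" "p \<in> Form n"
  shows "\<exists>q\<in>Form n. \<forall>x\<in>cube n. term_fun q x = min 1 (real m * term_fun p x)"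
proof (induction m)
  case 0
  with term_fun_const[OF assms(1), of 0] show ?case by auto
next
  case (Suc m)
  then obtain q where q: "q \<in> Form n" "\<forall>x\<in>cube n. term_fun q x = min 1 (real m * term_fun p x)"
    by auto
  have "term_fun (Neg p \<rightarrow>\<^sub>L q) x = min 1 (real (Suc m) * term_fun p x)" if "x \<in> cube n" for x
    using q(2) that term_fun_cube_bounds[OF assms(2) that] by (simp add: algebra_simps min_def)
  with q(1) assms(2) show ?case by (intro bexI[of _ "Neg p \<rightarrow>\<^sub>L q"]) auto
qed

text \<open>The truncated difference of the \<open>i\<close>-th coordinate and the constant
  \<open>x i\<close> vanishes at \<open>x\<close> and is positive at \<open>y\<close>. A large
  truncated multiple \<open>g\<close> of it has values 0 and 1, and rescaling \<open>g\<close> gives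
  \<open>a\<close> and \<open>b\<close>.\<close>

lemma term_fun_interpolate:
  assumes "n \<ge> 1" "x \<in> cube n" "y \<in> cube n" "i \<in> {1..n}" "x i < y i" "a \<in> {0..1}" "b \<in> {0..1}"
  shows "\<exists>p\<in>Form n. term_fun p x = a \<and> term_fun p y = b"
proof -
  have xi: "x i \<in> {0..1}" using assms by (auto simp: cube_def)
  obtain c where c: "c \<in> Form n" "\<And>z. term_fun c z = x i"
    using term_fun_const[OF assms(1) xi] by blast
  let ?v = "Neg (Var i \<rightarrow>\<^sub>L c)"
  have v: "?v \<in> Form n" using c assms(4) by simp
  obtain m where m: "1 < real m * (y i - x i)"
    using reals_Archimedean3[of "y i - x i"] assms(5) by auto
  obtain g where g: "g \<in> Form n" "\<forall>z\<in>cube n. term_fun g z = min 1 (real m * term_fun ?v z)"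
    using term_fun_multiple[OF assms(1) v] by blast
  have gx: "term_fun g x = 0" and gy: "term_fun g y = 1"
    using g assms(2,3,5) m by (simp_all add: c)
  \<comment> \<open>The scalar \<open>w - u\<close> must be nonnegative. If \<open>a > b\<close>,
    the step is therefore applied to \<open>Neg g\<close>, which has value 1 at \<open>x\<close> and
    0 at \<open>y\<close>.\<close>
  have step: "\<exists>p\<in>Form n. \<forall>z. term_fun p z = min 1 (u + (w - u) * term_fun h z)"
    if uw: "u \<in> {0..1}" "w \<in> {0..1}" "u \<le> w" and h: "h \<in> Form n" for u w h
  proof -
    obtain d where d: "d \<in> Form n" "\<And>z. term_fun d z = u"
      using term_fun_const[OF assms(1) uw(1)] by blast
    obtain r where "Rep_unit_interval r = w - u"
      using Rep_ui_cases[of "w - u"] uw by auto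
    with d h show ?thesis
      by (intro bexI[of _ "Neg d \<rightarrow>\<^sub>L Delta r h"]) (auto simp: term_fun_Delta)
  qed
  show ?thesis
  proof (cases "a \<le> b")
    case True
    from step[OF assms(6,7) this g(1)] obtain p
      where "p \<in> Form n" "\<forall>z. term_fun p z = min 1 (a + (b - a) * term_fun g z)" ..
    with assms(6,7) gx gy show ?thesis by (intro bexI[of _ p]) simp_all
  next
    case False
    then have "b \<le> a" "Neg g \<in> Form n" using g(1) by simp_all
    from step[OF assms(7,6) this] obtain p
      where "p \<in> Form n" "\<forall>z. term_fun p z = min 1 (b + (a - b) * (1 - term_fun g z))" by auto
    with assms(6,7) gx gy show ?thesis by (intro bexI[of _ p]) simp_all
  qed
qed

lemma term_fun_dense:
  assumes "n \<ge> 1" "continuous_on (cube n) f" "\<And>x. x \<in> cube n \<Longrightarrow> f x \<in> {0..1}" "e > 0"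
  shows "\<exists>p\<in>Form n. \<forall>x\<in>cube n. \<bar>term_fun p x - f x\<bar> < e"
proof -
  have "\<exists>g\<in>term_fun ` Form n. \<forall>x\<in>cube n. \<bar>g x - f x\<bar> < e"
  proof (rule lattice_Stone_Weierstrass[OF compact_cube cube_nonempty assms(2,4)])
    show "continuous_on (cube n) g" if "g \<in> term_fun ` Form n" for g
      using that continuous_on_term_fun by auto
    fix g h assume "g \<in> term_fun ` Form n" "h \<in> term_fun ` Form n"
    then obtain p q where pq: "p \<in> Form n" "q \<in> Form n" "g = term_fun p" "h = term_fun q" by blast
    note b = term_fun_cube_bounds[OF pq(1)] term_fun_cube_bounds[OF pq(2)]
    \<comment> \<open>On the cube \<open>\<or>\<^sub>L\<close> computes the maximum, so its De
      Morgan dual computes the minimum.\<close>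
    have "term_fun (Neg (Neg p \<or>\<^sub>L Neg q)) x = min (g x) (h x)" if "x \<in> cube n" for x
      using b[OF that] pq by (simp add: Disj_def min_def)
    moreover have "Neg (Neg p \<or>\<^sub>L Neg q) \<in> Form n" using pq by (simp add: Disj_def)
    ultimately show "\<exists>k\<in>term_fun ` Form n. \<forall>x\<in>cube n. k x = min (g x) (h x)" by blast
    have "term_fun (p \<or>\<^sub>L q) x = max (g x) (h x)" if "x \<in> cube n" for x
      using b[OF that] pq by (simp add: Disj_def min_def max_def)
    moreover have "p \<or>\<^sub>L q \<in> Form n" using pq by (simp add: Disj_def)
    ultimately show "\<exists>k\<in>term_fun ` Form n. \<forall>x\<in>cube n. k x = max (g x) (h x)" by blast
  next
    fix x y assume xy: "x \<in> cube n" "y \<in> cube n"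
    show "\<exists>g\<in>term_fun ` Form n. g x = f x \<and> g y = f y"
    proof (cases "x = y")
      case True
      with term_fun_const[OF assms(1) assms(3)[OF xy(1)]] show ?thesis by force
    next
      case False
      \<comment> \<open>Points of the cube agree outside \<open>{1..n}\<close>, so distinct points
        are separated by a variable of \<open>Form n\<close>.\<close>
      then obtain i where i: "i \<in> {1..n}" "x i \<noteq> y i"
        using xy PiE_ext unfolding cube_def by metis
      then consider "x i < y i" | "y i < x i" by linarith
      then show ?thesis
      proof cases
        case 1
        from term_fun_interpolate[OF assms(1) xy i(1) 1 assms(3) assms(3)] xy show ?thesis by blast
      next
        case 2
        from term_fun_interpolate[OF assms(1) xy(2,1) i(1) 2 assms(3) assms(3)] xy show ?thesis by blast
      qed
    qed
  qed
  then show ?thesis by blast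
qed

section \<open>Embedding the Lindenbaum-Tarski algebra\<close>

abbreviation fm_class :: "nat \<Rightarrow> fm \<Rightarrow> fm set" where
  "fm_class n p \<equiv> prov_equiv n `` {p}"

lemma prov_equiv_iff:
  "(p, q) \<in> prov_equiv n \<longleftrightarrow> p \<in> Form n \<and> q \<in> Form n \<and> \<turnstile>\<^sub>L p \<leftrightarrow>\<^sub>L q"
  by (simp add: prov_equiv_def)

lemma fm_class_eqI: "(p, q) \<in> prov_equiv n \<Longrightarrow> fm_class n p = fm_class n q"
  by (rule equiv_class_eq[OF equiv_prov_equiv])

lemma RL_simps:
  "carr (RL n) = carr (RL_alg n)"
  "\<zero>\<^bsub>RL n\<^esub> = \<zero>\<^bsub>RL_alg n\<^esub>"
  "X \<oplus>\<^bsub>RL n\<^esub> Y = X \<oplus>\<^bsub>RL_alg n\<^esub> Y"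
  "\<sim>\<^bsub>RL n\<^esub> X = \<sim>\<^bsub>RL_alg n\<^esub> X"
  "r \<cdot>\<^bsub>RL n\<^esub> X = r \<cdot>\<^bsub>RL_alg n\<^esub> X"
  "nrm (RL n) X = u_norm n X"
  "mdist (RL n) X Y = u_norm n (mv_dist (RL_alg n) X Y)"
  by (simp_all add: RL_def riesz_mv.extend_def normed_riesz_mv.fields_def)

lemma carr_RL_alg: "carr (RL_alg n) = fm_class n ` Form n"
  by (auto simp: RL_alg_def quotient_def)

text \<open>Provable equivalence is a congruence, so the union over representatives is a single
  class.\<close>

lemma RL_alg_oplus:
  assumes "p \<in> Form n" "q \<in> Form n"
  shows "fm_class n p \<oplus>\<^bsub>RL_alg n\<^esub> fm_class n q = fm_class n (Neg p \<rightarrow>\<^sub>L q)"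
proof -
  have "congruent2 (prov_equiv n) (prov_equiv n) (\<lambda>p q. fm_class n (Neg p \<rightarrow>\<^sub>L q))"
    by (rule congruent2I', rule fm_class_eqI) (simp add: prov_equiv_iff Iff_Imp_cong Iff_Neg_cong)
  from UN_equiv_class2[OF equiv_prov_equiv equiv_prov_equiv this assms]
  show ?thesis by (simp add: RL_alg_def)
qed

lemma RL_alg_neg:
  assumes "p \<in> Form n"
  shows "\<sim>\<^bsub>RL_alg n\<^esub> (fm_class n p) = fm_class n (Neg p)"
proof -
  have "congruent (prov_equiv n) (\<lambda>p. fm_class n (Neg p))"
    by (rule congruentI, rule fm_class_eqI) (simp add: prov_equiv_iff Iff_Neg_cong)
  from UN_equiv_class[OF equiv_prov_equiv this assms]
  show ?thesis by (simp add: RL_alg_def)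
qed

lemma RL_alg_scal:
  assumes "p \<in> Form n"
  shows "r \<cdot>\<^bsub>RL_alg n\<^esub> fm_class n p = fm_class n (Delta r p)"
proof -
  have "congruent (prov_equiv n) (\<lambda>p. fm_class n (Delta r p))"
    by (rule congruentI, rule fm_class_eqI) (simp add: prov_equiv_iff Iff_Delta_cong)
  from UN_equiv_class[OF equiv_prov_equiv this assms]
  show ?thesis by (simp add: RL_alg_def)
qed

lemma RL_alg_zero: "\<zero>\<^bsub>RL_alg n\<^esub> = fm_class n (Neg (Var 1 \<rightarrow>\<^sub>L Var 1))"
  by (simp add: RL_alg_def)

section \<open>Norm, metric and term function of a class\<close>

lemma the_elem_image_eq:
  assumes "p \<in> X" "\<And>q. q \<in> X \<Longrightarrow> f q = f p"
  shows "the_elem (f ` X) = f p"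
proof -
  have "f ` X = (\<lambda>_. f p) ` X" using assms(2) by (rule image_cong[OF refl])
  then show ?thesis using assms(1) by (auto simp: image_constant_conv)
qed

lemma u_norm_fm_class:
  assumes "p \<in> Form n"
  shows "u_norm n (fm_class n p) = (SUP x\<in>cube n. term_fun p x)"
  unfolding u_norm_def
proof (rule the_elem_image_eq)
  show "p \<in> fm_class n p" by (rule equiv_class_self[OF equiv_prov_equiv assms])
  fix q assume "q \<in> fm_class n p"
  then show "(SUP x\<in>cube n. term_fun q x) = (SUP x\<in>cube n. term_fun p x)"
    by (intro SUP_cong refl) (auto dest: prov_equiv_term_fun)
qed

text \<open>The map sending the class of a formula to its term function. Restriction comes before
  \<open>the_elem\<close>, because soundness makes equivalent formulas agree on the cube
  only.\<close>

definition class_fun :: "nat \<Rightarrow> fm set \<Rightarrow> (nat \<Rightarrow> real) \<Rightarrow> real" where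
  "class_fun n X = the_elem ((\<lambda>p. restrict (term_fun p) (cube n)) ` X)"

lemma class_fun_fm_class:
  assumes "p \<in> Form n"
  shows "class_fun n (fm_class n p) = restrict (term_fun p) (cube n)"
  unfolding class_fun_def
proof (rule the_elem_image_eq)
  show "p \<in> fm_class n p" by (rule equiv_class_self[OF equiv_prov_equiv assms])
  fix q assume "q \<in> fm_class n p"
  then show "restrict (term_fun q) (cube n) = restrict (term_fun p) (cube n)"
    by (intro restrict_ext) (auto dest: prov_equiv_term_fun)
qed

lemma RL_mdist:
  assumes "p \<in> Form n" "q \<in> Form n"
  shows "mdist (RL n) (fm_class n p) (fm_class n q)
    = (SUP x\<in>cube n. \<bar>term_fun p x - term_fun q x\<bar>)"
proof -
  \<comment> \<open>This representative of the class \<open>mv_dist\<close> results from unfolding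
    \<open>odot\<close> and replacing each operation on classes by its connective.\<close>
  let ?d = "Neg (Neg (Neg (Neg (Neg p)) \<rightarrow>\<^sub>L Neg q)) \<rightarrow>\<^sub>L Neg (Neg (Neg p) \<rightarrow>\<^sub>L Neg (Neg q))"
  have "mdist (RL n) (fm_class n p) (fm_class n q) = u_norm n (fm_class n ?d)"
    using assms by (simp add: RL_simps mv_dist_def odot_def RL_alg_neg RL_alg_oplus)
  also have "\<dots> = (SUP x\<in>cube n. term_fun ?d x)"
    using assms by (intro u_norm_fm_class) simp
  also have "\<dots> = (SUP x\<in>cube n. \<bar>term_fun p x - term_fun q x\<bar>)"
  proof (intro SUP_cong refl)
    fix x assume "x \<in> cube n"
    then have "term_fun p x \<in> {0..1}" "term_fun q x \<in> {0..1}"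
      using assms by (auto dest: term_fun_cube_bounds)
    \<comment> \<open>One of the two truncated differences is 0 and the other is the absolute
      difference.\<close>
    then show "term_fun ?d x = \<bar>term_fun p x - term_fun q x\<bar>"
      by (simp add: min_def)
  qed
  finally show ?thesis .
qed

lemma dense_isometric_embedding_RL:
  assumes "n \<ge> 1"
  shows "dense_isometric_embedding (C_cube n) (RL n) (class_fun n)"
proof -
  interpret C: normed_riesz_mv_algebra "C_cube n" by (rule normed_riesz_mv_algebra_C_cube)
  have zero: "Neg (Var 1 \<rightarrow>\<^sub>L Var 1) \<in> Form n" using assms by simp
  show ?thesis
  proof
    show "\<exists>f\<in>carr (C_cube n). (\<lambda>k. mdist (C_cube n) (s k) f) \<longlonglongrightarrow> 0"
      if "s \<in> cauchy_seqs (C_cube n)" for s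
      using that by (rule C_cube_complete)
    show "\<zero>\<^bsub>RL n\<^esub> \<in> carr (RL n)"
      unfolding RL_simps carr_RL_alg RL_alg_zero using zero by (rule imageI)
    show "class_fun n \<zero>\<^bsub>RL n\<^esub> = \<zero>\<^bsub>C_cube n\<^esub>"
      unfolding RL_simps RL_alg_zero class_fun_fm_class[OF zero] C_cube_simps
      by (rule restrict_ext) simp
  next
    fix X assume "X \<in> carr (RL n)"
    then obtain p where p: "p \<in> Form n" "X = fm_class n p"
      by (auto simp: RL_simps carr_RL_alg)
    show "\<sim>\<^bsub>RL n\<^esub> X \<in> carr (RL n)" "r \<cdot>\<^bsub>RL n\<^esub> X \<in> carr (RL n)" for r
      using p by (auto simp: RL_simps carr_RL_alg RL_alg_neg RL_alg_scal)
    show "class_fun n X \<in> carr (C_cube n)"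
      unfolding p(2) class_fun_fm_class[OF p(1)]
      by (rule restrict_in_C_cube[OF continuous_on_term_fun term_fun_cube_bounds[OF p(1)]])
    show "class_fun n (\<sim>\<^bsub>RL n\<^esub> X) = \<sim>\<^bsub>C_cube n\<^esub> (class_fun n X)"
      using p by (auto simp: RL_simps RL_alg_neg class_fun_fm_class C_cube_simps intro!: restrict_ext)
    show "class_fun n (r \<cdot>\<^bsub>RL n\<^esub> X) = r \<cdot>\<^bsub>C_cube n\<^esub> class_fun n X" for r
      using p by (auto simp: RL_simps RL_alg_scal class_fun_fm_class C_cube_simps term_fun_Delta
          intro!: restrict_ext)
    \<comment> \<open>\<open>u_norm\<close> takes suprema without absolute values; term functions
      are nonnegative on the cube, so both norms agree.\<close>
    show "nrm (C_cube n) (class_fun n X) = nrm (RL n) X"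
      using p term_fun_cube_bounds[OF p(1)]
      by (auto simp: RL_simps u_norm_fm_class class_fun_fm_class C_cube_simps intro!: SUP_cong)
    fix Y assume "Y \<in> carr (RL n)"
    then obtain q where q: "q \<in> Form n" "Y = fm_class n q"
      by (auto simp: RL_simps carr_RL_alg)
    show "X \<oplus>\<^bsub>RL n\<^esub> Y \<in> carr (RL n)"
      using p q by (auto simp: RL_simps carr_RL_alg RL_alg_oplus)
    show "class_fun n (X \<oplus>\<^bsub>RL n\<^esub> Y) = class_fun n X \<oplus>\<^bsub>C_cube n\<^esub> class_fun n Y"
      using p q by (auto simp: RL_simps RL_alg_oplus class_fun_fm_class C_cube_simps
          intro!: restrict_ext)
    show "mdist (C_cube n) (class_fun n X) (class_fun n Y) = mdist (RL n) X Y"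
      using p q by (auto simp: RL_mdist class_fun_fm_class C_cube_simps intro!: SUP_cong)
  next
    fix f and e :: real assume f: "f \<in> carr (C_cube n)" and "e > 0"
    then obtain p where p: "p \<in> Form n"
      and close: "\<And>x. x \<in> cube n \<Longrightarrow> \<bar>term_fun p x - f x\<bar> < e / 2"
      using term_fun_dense[OF assms C_cube_continuous[OF f], of "e / 2"] C_cube_bounds[OF f] by auto
    have "restrict (term_fun p) (cube n) \<in> carr (C_cube n)"
      by (rule restrict_in_C_cube[OF continuous_on_term_fun term_fun_cube_bounds[OF p]])
    then have "mdist (C_cube n) (class_fun n (fm_class n p)) f \<le> e / 2"
      using close by (subst class_fun_fm_class[OF p], subst C_cube_mdist_le_iff[OF _ f])
        (auto intro: less_imp_le)
    with p \<open>e > 0\<close> show "\<exists>X\<in>carr (RL n). mdist (C_cube n) (class_fun n X) f < e"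
      by (intro bexI[of _ "fm_class n p"]) (auto simp: RL_simps carr_RL_alg)
  qed
qed

theorem theorem2p15:
  fixes n :: nat
  assumes "n \<ge> 1"
  shows "isometrically_isomorphic (norm_completion (RL n)) (C_cube n)"
proof -
  interpret dense_isometric_embedding "C_cube n" "RL n" "class_fun n"
    by (rule dense_isometric_embedding_RL[OF assms])
  note iso = isometric_isomorphism_seqs_to and C = riesz_mv_algebra_C_cube
  show ?thesis
    unfolding isometrically_isomorphic_def
    \<comment> \<open>\<open>seqs_to\<close> leads from the continuous functions to the completion.
      It transports the algebraic laws, and its inverse is the isomorphism in the required
      direction.\<close>
    using riesz_mv_algebra_isometric_isomorphism[OF iso C] C isometric_isomorphism_inv[OF iso C]
    by blast
qed

end
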